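(* Let $d\ge 1$ be an integer, let $s_0=0<s_1<s_2<\dots<s_d$ be real numbers and let $t_0=0\le t_1<t_2<\dots<t_d\le 1=t_{d+1}$. Let $\mathbb{B}^{ex}=(\mathbb{B}^{ex}_t)_{t\in[0,1]}$ be the (normalized, positive) Brownian excursion, and let $(X_t)_{t\ge 0}$ be the Markov process on $[0,\infty)$ with transition densities $$p_t(x,y)=\frac{2t\sqrt{y}}{\pi\left[(y-x)^2+2(x+y)t^2+t^4\right]},\qquad t>0,\ x,y\ge 0,$$ with $\mathbb{E}_x$ denoting expectation when $X_0=x$. Then $$\mathbb{E}\left[\exp\left(-\sum_{k=1}^d (s_k-s_{k-1})\mathbb{B}^{ex}_{t_k}\right)\right]=\frac{1}{\sqrt{2\pi}}\int_0^\infty \mathbb{E}_x\left[\exp\left(-\frac12\sum_{k=0}^{d}(t_{k+1}-t_k)X_{s_k}\right)\right]\sqrt{x}\,dx.$$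
   Context: Brownian excursion: $\mathbb{B}^{ex}=(\mathbb{B}^{ex}_t)_{t\in[0,1]}$ is the process with $\mathbb{B}^{ex}_0=\mathbb{B}^{ex}_1=0$ whose joint density at times $0<t_1<\dots<t_d<1$ is $$f_{t_1,\dots,t_d}(y_1,\dots,y_d)=\sqrt{8\pi}\,\ell_{t_1}(y_1)\,\ell_{1-t_d}(y_d)\prod_{k=1}^{d-1}g_{t_{k+1}-t_k}(y_k,y_{k+1}),$$ where $$\ell_t(y)=\frac{1}{\sqrt{2\pi t^3}}\,y\,e^{-y^2/(2t)}\mathbf{1}_{\{y>0\}},\qquad g_t(y_1,y_2)=\frac{1}{\sqrt{2\pi t}}\left[e^{-(y_1-y_2)^2/(2t)}-e^{-(y_1+y_2)^2/(2t)}\right]\mathbf{1}_{\{y_1,y_2>0\}}.$$ Process $X$: $(X_t)_{t\ge0}$ is the time-homogeneous Markov process with state space $[0,\infty)$ and transition probabilities $\mathbb{P}(X_t\in dy\mid X_s=x)=p_{t-s}(x,y)\,dy$ for $0\le s<t$, $x\ge 0$, with $p_t(x,y)$ as in the statement. For $x>0$, $\mathbb{E}_x$ is the expectation for the law of $(X_t)_{t\ge 0}$ started at $X_0=x$. *)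

theory Defs
  imports "HOL-Probability.Probability"
begin

text \<open>
  \<open>entrance_density t y\<close> is the function \<open>\<ell>\<^sub>t(y)\<close> and \<open>killed_density\<close> is the transition density
  \<open>g\<^sub>t\<close> of Brownian motion killed at \<open>0\<close>; in \<open>excursion_density\<close>, the times and the arguments
  are indexed by \<open>1, \<dots>, n\<close>.
\<close>

definition entrance_density :: "real \<Rightarrow> real \<Rightarrow> real" where
  "entrance_density t y =
     1 / sqrt (2 * pi * t ^ 3) * y * exp (- y\<^sup>2 / (2 * t)) * indicator {0<..} y"

definition killed_density :: "real \<Rightarrow> real \<Rightarrow> real \<Rightarrow> real" where
  "killed_density t y1 y2 =
     1 / sqrt (2 * pi * t) *
       (exp (- (y1 - y2)\<^sup>2 / (2 * t)) - exp (- (y1 + y2)\<^sup>2 / (2 * t))) *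
       indicator ({0<..} \<times> {0<..}) (y1, y2)"

definition excursion_density :: "nat \<Rightarrow> (nat \<Rightarrow> real) \<Rightarrow> (nat \<Rightarrow> real) \<Rightarrow> real" where
  "excursion_density n t y =
     sqrt (8 * pi) * entrance_density (t 1) (y 1) * entrance_density (1 - t n) (y n) *
       (\<Prod>k\<in>{1..<n}. killed_density (t (k + 1) - t k) (y k) (y (k + 1)))"

text \<open>
  The Brownian excursion is specified through its finite-dimensional distributions only;
  \<open>B t\<close> is constrained for \<open>t \<in> [0,1]\<close>, and no path regularity is required.
\<close>

locale brownian_excursion = prob_space M
  for M :: "'a measure" and B :: "real \<Rightarrow> 'a \<Rightarrow> real" +
  assumes excursion_measurable: "\<And>t. t \<in> {0..1} \<Longrightarrow> B t \<in> borel_measurable M"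
    and excursion_start: "AE \<omega> in M. B 0 \<omega> = 0"
    and excursion_end: "AE \<omega> in M. B 1 \<omega> = 0"
    and excursion_joint_density:
      "\<And>(n::nat) t. 1 \<le> n \<Longrightarrow> 0 < t 1 \<Longrightarrow> strict_mono_on {1..n} t \<Longrightarrow> t n < 1 \<Longrightarrow>
         distributed M (\<Pi>\<^sub>M k\<in>{1..n}. lborel) (\<lambda>\<omega>. \<lambda>k\<in>{1..n}. B (t k) \<omega>)
           (\<lambda>y. ennreal (excursion_density n t y))"

definition past_sigma :: "'a measure \<Rightarrow> (real \<Rightarrow> 'a \<Rightarrow> real) \<Rightarrow> real \<Rightarrow> 'a measure" where
  "past_sigma M X s =
     sigma (space M) {X u -` A \<inter> space M | u A. 0 \<le> u \<and> u \<le> s \<and> A \<in> sets borel}"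

text \<open>
  A time-homogeneous Markov process \<open>(X t)\<close>, \<open>t \<ge> 0\<close>, with state space \<open>S\<close>, transition
  probabilities \<open>K t x\<close> (for \<open>t > 0\<close>) and initial state \<open>x0\<close>. The Markov property is
  \<open>P(X t \<in> A | \<sigma>(X u, 0 \<le> u \<le> s)) = K (t - s) (X s) A\<close> almost surely.
\<close>

locale markov_process_from = prob_space M
  for M :: "'a measure" and S :: "real set" and K :: "real \<Rightarrow> real \<Rightarrow> real measure"
    and X :: "real \<Rightarrow> 'a \<Rightarrow> real" and x0 :: real +
  assumes process_measurable: "\<And>t. 0 \<le> t \<Longrightarrow> X t \<in> borel_measurable M"
    and process_state_space: "\<And>t \<omega>. 0 \<le> t \<Longrightarrow> \<omega> \<in> space M \<Longrightarrow> X t \<omega> \<in> S"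
    and process_start: "AE \<omega> in M. X 0 \<omega> = x0"
    and process_markov:
      "\<And>s t A. 0 \<le> s \<Longrightarrow> s < t \<Longrightarrow> A \<in> sets borel \<Longrightarrow>
         AE \<omega> in M. real_cond_exp M (past_sigma M X s) (\<lambda>\<omega>. indicator A (X t \<omega>)) \<omega> =
           measure (K (t - s) (X s \<omega>)) A"

definition trans_density :: "real \<Rightarrow> real \<Rightarrow> real \<Rightarrow> real" where
  "trans_density t x y =
     2 * t * sqrt y / (pi * ((y - x)\<^sup>2 + 2 * (x + y) * t\<^sup>2 + t ^ 4))"

text \<open>The indicator restricts the density to the state space \<open>[0,\<infinity>)\<close>.\<close>

definition trans_prob :: "real \<Rightarrow> real \<Rightarrow> real measure" where
  "trans_prob t x = density lborel (\<lambda>y. ennreal (trans_density t x y * indicator {0..} y))"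

end

theory Submission
  imports Defs
begin

text \<open>
  Both sides are Laplace functionals of Markov chains, and the sine transform carries one into
  the other. The kernel \<open>g\<^sub>t\<close> of the killed Brownian motion is diagonal in the basis \<open>sin (u y)\<close>,
  with eigenvalue \<open>exp (- t u\<^sup>2 / 2)\<close>, and \<open>\<ell>\<^sub>t\<close> is the sine transform of \<open>u exp (- t u\<^sup>2 / 2)\<close>
  (\<open>killed_density_amplitude\<close>, \<open>entrance_density_amplitude\<close>). In the same basis, multiplication by
  \<open>exp (- s y)\<close> has the kernel
  \<open>\<integral>\<^sub>0\<^sup>\<infinity> exp (- s y) sin (u y) sin (v y) dy = 2 s u v / ((v\<^sup>2 - u\<^sup>2)\<^sup>2 + 2 (u\<^sup>2 + v\<^sup>2) s\<^sup>2 + s\<^sup>4)\<close>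
  (\<open>laplace_sin_sin\<close>), which after the substitution \<open>x = u\<^sup>2\<close>, \<open>y = v\<^sup>2\<close> is, up to the factors that the
  substitution produces, the density \<open>p\<^sub>s(x, y)\<close>. So the two operations of the excursion side, "run for
  a time \<open>t\<close>" and "multiply by \<open>exp (- s y)\<close>", become the two operations "multiply by
  \<open>exp (- t x / 2)\<close>" and "run for a time \<open>s\<close>" of the dual side: times and rates exchange their
  roles.

  To make this precise, both expectations are written as iterated one-dimensional integrals,
  integrating out the last coordinate first: \<open>killed_laplace\<close> for the excursion and \<open>dual_laplace\<close>
  for \<open>X\<close>. An induction on the number of steps (\<open>killed_laplace_eq_sine\<close>) shows that the former is
  the sine transform of the latter, and integrating against \<open>\<ell>\<close> at the first time gives the weight
  \<open>\<surd>x dx\<close> (\<open>entrance_killed_laplace\<close>). Each step is one application of Fubini's theorem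
  (\<open>parseval_damped_sine\<close>); it converges absolutely because every time increment and every rate is
  strictly positive.

  Two boundary cases, \<open>t\<^sub>1 = 0\<close> and \<open>t\<^sub>d = 1\<close>, have a vanishing time increment. At these times
  the excursion is \<open>0\<close> almost surely and contributes nothing to the exponent. On the dual side,
  \<open>X\<close> at time \<open>s\<^sub>d\<close> or \<open>s\<^sub>0\<close> has weight \<open>0\<close> and is integrated out: the last position because
  \<open>p\<^sub>s(x, \<cdot>)\<close> has total mass \<open>1\<close>, the first one because \<open>p\<close> is reversible with respect to the
  measure \<open>\<surd>x dx\<close>, which is therefore invariant. What remains is a chain with strictly positive
  increments, or the empty chain, for which the identity says that
  \<open>\<integral>\<^sub>0\<^sup>\<infinity> \<surd>x exp (- x / 2) dx = \<surd>(2 \<pi>)\<close>.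
\<close>

section \<open>Sine transforms of the Brownian kernels\<close>

lemma integrable_gaussian_power:
  fixes c :: real
  assumes "0 < c"
  shows "integrable lborel (\<lambda>u. exp (- (c * u\<^sup>2) / 2) * u ^ k)"
proof -
  have "integrable lborel (\<lambda>u. sqrt (2 * pi / c) * (normal_density 0 (1 / sqrt c) u * (u - 0) ^ k))"
    by (intro integrable_mult_right integrable_normal_moment) (use assms in simp)
  also have "(\<lambda>u. sqrt (2 * pi / c) * (normal_density 0 (1 / sqrt c) u * (u - 0) ^ k)) =
      (\<lambda>u. exp (- (c * u\<^sup>2) / 2) * u ^ k)"
    using assms by (auto simp: normal_density_def fun_eq_iff power_divide real_sqrt_divide field_simps)
  finally show ?thesis .
qed

text \<open>
  This is the characteristic function of the standard normal distribution, rescaled.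
\<close>

lemma gaussian_cos_integral:
  fixes a c :: real
  assumes "0 < c"
  shows "(LBINT u. exp (- (c * u\<^sup>2) / 2) * cos (a * u)) = sqrt (2 * pi / c) * exp (- a\<^sup>2 / (2 * c))"
proof -
  \<comment> \<open>The substitution \<open>x = sqrt c * u\<close> turns \<open>cos (b * x)\<close> into \<open>cos (a * u)\<close>.\<close>
  define b where "b = a / sqrt c"
  have int: "integrable std_normal_distribution (\<lambda>x. iexp (b * x))"
    using real_dist_normal_dist
    by (intro prob_space.integrable_iexp) (auto simp: real_distribution_def)
  have "exp (- b\<^sup>2 / 2) = Re (char std_normal_distribution b)"
    by (subst char_std_normal_distribution) (rule Re_complex_of_real[symmetric])
  also have "\<dots> = (\<integral>x. Re (iexp (b * x)) \<partial>std_normal_distribution)"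
    unfolding char_def using int by (rule integral_Re[symmetric])
  also have "\<dots> = (\<integral>x. cos (b * x) \<partial>std_normal_distribution)"
    by (simp add: Re_exp)
  also have "\<dots> = (LBINT x. std_normal_density x * cos (b * x))"
    by (subst integral_density) auto
  also have "\<dots> = sqrt c * (LBINT u. std_normal_density (sqrt c * u) * cos (b * (sqrt c * u)))"
    using assms by (subst lborel_integral_real_affine[where c = "sqrt c" and t = 0]) auto
  also have "(\<lambda>u. std_normal_density (sqrt c * u) * cos (b * (sqrt c * u))) =
      (\<lambda>u. 1 / sqrt (2 * pi) * (exp (- (c * u\<^sup>2) / 2) * cos (a * u)))"
    using assms by (auto simp: fun_eq_iff std_normal_density_def b_def power_mult_distrib)
  finally have "exp (- b\<^sup>2 / 2) =
      sqrt c * (1 / sqrt (2 * pi) * (LBINT u. exp (- (c * u\<^sup>2) / 2) * cos (a * u)))"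
    by simp
  moreover have "b\<^sup>2 = a\<^sup>2 / c" using assms by (simp add: b_def power_divide)
  ultimately show ?thesis
    using assms by (simp add: real_sqrt_divide field_simps)
qed

text \<open>
  Integration by parts reduces this to \<open>gaussian_cos_integral\<close>: the integral over the line of the
  derivative of \<open>exp (- c u\<^sup>2 / 2) sin (a u)\<close> is zero.
\<close>

lemma gaussian_sin_moment:
  fixes a c :: real
  assumes "0 < c"
  shows "(LBINT u. exp (- (c * u\<^sup>2) / 2) * (u * sin (a * u))) =
    a / c * sqrt (2 * pi / c) * exp (- a\<^sup>2 / (2 * c))"
proof -
  let ?e = "\<lambda>u::real. exp (- (c * u\<^sup>2) / 2)"
  let ?f = "\<lambda>u. a * (?e u * cos (a * u)) - c * (?e u * (u * sin (a * u)))"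
  have int_cos: "integrable lborel (\<lambda>u. ?e u * cos (a * u))"
    by (rule Bochner_Integration.integrable_bound[OF integrable_gaussian_power[OF assms, of 0]])
       (auto simp: abs_mult intro!: mult_left_le)
  have int_sin: "integrable lborel (\<lambda>u. ?e u * (u * sin (a * u)))"
    by (rule Bochner_Integration.integrable_bound[OF integrable_gaussian_power[OF assms, of 1]])
       (auto simp: abs_mult intro!: mult_left_mono mult_left_le)
  have int: "integrable lborel ?f" using int_cos int_sin by auto
  have lim0: "(?e \<longlongrightarrow> 0) at_top" "(?e \<longlongrightarrow> 0) at_bot"
    using assms by real_asymp+
  have lim: "((\<lambda>u. ?e u * sin (a * u)) \<longlongrightarrow> 0) at_top" "((\<lambda>u. ?e u * sin (a * u)) \<longlongrightarrow> 0) at_bot"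
    by (rule Lim_null_comparison[OF _ lim0(1)], simp add: abs_mult mult_left_le,
        rule Lim_null_comparison[OF _ lim0(2)], simp add: abs_mult mult_left_le)
  have "(LBINT u=-\<infinity>..\<infinity>. ?f u) = 0 - 0"
  proof (rule interval_integral_FTC_integrable)
    show "((\<lambda>u. ?e u * sin (a * u)) has_vector_derivative ?f x) (at x)" for x
      unfolding has_real_derivative_iff_has_vector_derivative[symmetric]
      by (auto intro!: derivative_eq_intros simp: algebra_simps)
    show "set_integrable lborel (einterval (-\<infinity>) \<infinity>) ?f"
      using int by (simp add: set_integrable_def)
  qed (use lim in \<open>auto simp: ereal_tendsto_simps1 intro!: continuous_intros\<close>)
  also have "(LBINT u=-\<infinity>..\<infinity>. ?f u) = (LBINT u. ?f u)"
    by (simp add: interval_integral_to_infinity_eq interval_lebesgue_integral_def set_lebesgue_integral_def)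
  finally have "(LBINT u. ?f u) = 0" by simp
  then have "c * (LBINT u. ?e u * (u * sin (a * u))) = a * (LBINT u. ?e u * cos (a * u))"
    using int_cos int_sin by simp
  then have "c * (LBINT u. ?e u * (u * sin (a * u))) =
      a * (sqrt (2 * pi / c) * exp (- a\<^sup>2 / (2 * c)))"
    unfolding gaussian_cos_integral[OF assms] .
  then show ?thesis using assms by (simp add: field_simps)
qed

lemma integrable_exp_halfline:
  fixes s :: real
  assumes "0 < s"
  shows "integrable lborel (\<lambda>z. indicator {0<..} z * exp (- (s * z)))"
  using integrable_I0i_exp_mscale[OF assms] by (simp add: set_integrable_def mult.commute)

lemma integrable_exp_trig_halfline:
  fixes s :: real
  assumes "0 < s" and [measurable]: "f \<in> borel_measurable borel" and "\<And>z. \<bar>f z\<bar> \<le> 1"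
  shows "integrable lborel (\<lambda>z. indicator {0<..} z * exp (- (s * z)) * f z)"
  by (rule Bochner_Integration.integrable_bound[OF integrable_exp_halfline[OF assms(1)]])
     (use assms(3) in \<open>auto simp: abs_mult intro!: mult_left_le\<close>)

lemma laplace_cos:
  fixes a s :: real
  assumes "0 < s"
  shows "(LBINT z. indicator {0<..} z * exp (- (s * z)) * cos (a * z)) = s / (s\<^sup>2 + a\<^sup>2)"
proof -
  let ?F = "\<lambda>z. exp (- (s * z)) * (a * sin (a * z) - s * cos (a * z)) / (s\<^sup>2 + a\<^sup>2)"
  have pos: "s\<^sup>2 + a\<^sup>2 > 0" using assms by (simp add: add_pos_nonneg)
  have "((\<lambda>z. exp (- (s * z)) * ((\<bar>a\<bar> + s) / (s\<^sup>2 + a\<^sup>2))) \<longlongrightarrow> 0) at_top"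
    by (rule tendsto_mult_left_zero) (use assms in real_asymp)
  then have lim: "(?F \<longlongrightarrow> 0) at_top"
  proof (rule Lim_null_comparison[rotated], intro always_eventually allI)
    fix z :: real
    have "\<bar>a * sin (a * z) - s * cos (a * z)\<bar> \<le> \<bar>a * sin (a * z)\<bar> + \<bar>s * cos (a * z)\<bar>" by simp
    also have "\<dots> \<le> \<bar>a\<bar> + s"
      using assms by (intro add_mono) (auto simp: abs_mult intro!: mult_left_le)
    finally show "norm (?F z) \<le> exp (- (s * z)) * ((\<bar>a\<bar> + s) / (s\<^sup>2 + a\<^sup>2))"
      using pos by (auto simp: abs_mult intro!: divide_right_mono)
  qed
  have "isCont ?F 0" using pos by (intro continuous_intros) auto
  then have lim0: "(?F \<longlongrightarrow> ?F 0) (at_right 0)"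
    by (auto simp: isCont_def intro: tendsto_mono[OF at_le])
  have "(LBINT z=0..\<infinity>. exp (- (s * z)) * cos (a * z)) = 0 - ?F 0"
  proof (rule interval_integral_FTC_integrable)
    show "(?F has_vector_derivative exp (- (s * x)) * cos (a * x)) (at x)" for x
      unfolding has_real_derivative_iff_has_vector_derivative[symmetric]
      using pos by (auto intro!: derivative_eq_intros simp: divide_simps; simp add: algebra_simps power2_eq_square)
    show "set_integrable lborel (einterval 0 \<infinity>) (\<lambda>z. exp (- (s * z)) * cos (a * z))"
      using integrable_exp_trig_halfline[OF assms, of "\<lambda>z. cos (a * z)"]
      by (simp add: set_integrable_def zero_ereal_def mult.assoc)
    show "((?F \<circ> real_of_ereal) \<longlongrightarrow> ?F 0) (at_right 0)"
      using lim0 unfolding zero_ereal_def ereal_tendsto_simps1 .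
    show "((?F \<circ> real_of_ereal) \<longlongrightarrow> 0) (at_left \<infinity>)"
      using lim unfolding ereal_tendsto_simps1 .
  qed (auto intro!: continuous_intros)
  then show ?thesis
    by (simp add: interval_lebesgue_integral_0_infty set_lebesgue_integral_def mult.assoc)
qed

text \<open>
  The product of sines is half the difference of \<open>cos ((u - v) z)\<close> and \<open>cos ((u + v) z)\<close>. The two
  resulting denominators \<open>s\<^sup>2 + (u \<mp> v)\<^sup>2\<close> multiply to the denominator of \<open>trans_density\<close> at
  \<open>(u\<^sup>2, v\<^sup>2)\<close>.
\<close>

lemma laplace_sin_sin:
  fixes s u v :: real
  assumes "0 < s"
  shows "(LBINT z. indicator {0<..} z * exp (- (s * z)) * (sin (u * z) * sin (v * z))) =
    2 * s * u * v / ((v\<^sup>2 - u\<^sup>2)\<^sup>2 + 2 * (u\<^sup>2 + v\<^sup>2) * s\<^sup>2 + s ^ 4)"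
proof -
  let ?e = "\<lambda>z. indicator {0<..} z * exp (- (s * z))"
  have eq: "?e z * (sin (u * z) * sin (v * z)) =
      1 / 2 * (?e z * cos ((u - v) * z) - ?e z * cos ((u + v) * z))" for z
    by (simp add: cos_diff cos_add algebra_simps)
  have "(LBINT z. ?e z * (sin (u * z) * sin (v * z))) =
      1 / 2 * (s / (s\<^sup>2 + (u - v)\<^sup>2) - s / (s\<^sup>2 + (u + v)\<^sup>2))"
    unfolding eq
    by (simp add: integrable_exp_trig_halfline assms laplace_cos)
  also have "\<dots> = 1 / 2 * (4 * s * u * v / ((s\<^sup>2 + (u - v)\<^sup>2) * (s\<^sup>2 + (u + v)\<^sup>2)))"
  proof -
    have "s\<^sup>2 + (u - v)\<^sup>2 > 0" "s\<^sup>2 + (u + v)\<^sup>2 > 0" using assms by (auto simp: add_pos_nonneg)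
    then have "s / (s\<^sup>2 + (u - v)\<^sup>2) - s / (s\<^sup>2 + (u + v)\<^sup>2) =
        (s * (s\<^sup>2 + (u + v)\<^sup>2) - s * (s\<^sup>2 + (u - v)\<^sup>2)) / ((s\<^sup>2 + (u - v)\<^sup>2) * (s\<^sup>2 + (u + v)\<^sup>2))"
      by (intro diff_frac_eq) auto
    also have "s * (s\<^sup>2 + (u + v)\<^sup>2) - s * (s\<^sup>2 + (u - v)\<^sup>2) = 4 * s * u * v" by algebra
    finally show ?thesis by (rule arg_cong)
  qed
  also have "(s\<^sup>2 + (u - v)\<^sup>2) * (s\<^sup>2 + (u + v)\<^sup>2) = (v\<^sup>2 - u\<^sup>2)\<^sup>2 + 2 * (u\<^sup>2 + v\<^sup>2) * s\<^sup>2 + s ^ 4"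
    by algebra
  finally show ?thesis by simp
qed

lemma entrance_density_eq_sine:
  assumes "0 < c" "0 < y"
  shows "entrance_density c y = 1 / (2 * pi) * (LBINT u. exp (- (c * u\<^sup>2) / 2) * u * sin (u * y))"
proof -
  have q: "sqrt (2 * pi * c ^ 3) = c * sqrt c * sqrt (2 * pi)"
    using assms by (simp add: power3_eq_cube real_sqrt_mult)
  have "(LBINT u. exp (- (c * u\<^sup>2) / 2) * u * sin (u * y)) =
      y / c * (sqrt (2 * pi) / sqrt c) * exp (- y\<^sup>2 / (2 * c))"
    using gaussian_sin_moment[OF assms(1), of y] by (simp only: mult.assoc mult.commute[of y] real_sqrt_divide)
  also have "1 / (2 * pi) * \<dots> = 1 / (c * sqrt c * sqrt (2 * pi)) * y * exp (- y\<^sup>2 / (2 * c))"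
  proof -
    have "1 / (2 * pi) = 1 / (sqrt (2 * pi) * sqrt (2 * pi))" by simp
    then show ?thesis using assms by (simp only:) (simp add: divide_simps)
  qed
  finally show ?thesis using assms by (simp add: entrance_density_def q)
qed

lemma killed_density_eq_sine:
  assumes "0 < c" "0 < y" "0 < z"
  shows "killed_density c y z = 1 / pi * (LBINT u. exp (- (c * u\<^sup>2) / 2) * sin (u * y) * sin (u * z))"
proof -
  let ?e = "\<lambda>u::real. exp (- (c * u\<^sup>2) / 2)"
  have int: "integrable lborel (\<lambda>u. ?e u * cos (a * u))" for a
    by (rule Bochner_Integration.integrable_bound[OF integrable_gaussian_power[OF assms(1), of 0]])
       (auto simp: abs_mult intro!: mult_left_le)
  have eq: "?e u * sin (u * y) * sin (u * z) =
      1 / 2 * (?e u * cos ((y - z) * u) - ?e u * cos ((y + z) * u))" for u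
    by (simp add: cos_diff cos_add algebra_simps)
  have "(LBINT u. ?e u * sin (u * y) * sin (u * z)) = 1 / 2 * (sqrt (2 * pi / c) * exp (- (y - z)\<^sup>2 / (2 * c))
      - sqrt (2 * pi / c) * exp (- (y + z)\<^sup>2 / (2 * c)))"
    unfolding eq integral_mult_right_zero
    by (subst Bochner_Integration.integral_diff[OF int int]) (simp only: gaussian_cos_integral[OF assms(1)])
  also have "\<dots> = 1 / 2 * (sqrt (2 * pi) / sqrt c) *
      (exp (- (y - z)\<^sup>2 / (2 * c)) - exp (- (y + z)\<^sup>2 / (2 * c)))"
    by (simp add: real_sqrt_divide right_diff_distrib)
  also have "1 / pi * \<dots> = 1 / (sqrt (2 * pi) * sqrt c) *
      (exp (- (y - z)\<^sup>2 / (2 * c)) - exp (- (y + z)\<^sup>2 / (2 * c)))"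
  proof -
    have "1 / pi = 2 / (sqrt (2 * pi) * sqrt (2 * pi))" by simp
    then show ?thesis using assms by (simp only:) (simp add: divide_simps)
  qed
  finally show ?thesis using assms by (simp add: killed_density_def real_sqrt_mult)
qed

text \<open>
  The amplitude is odd in \<open>u\<close>, so that its product with the sine is even; the sine transform is
  therefore written as an integral over the whole line, with half the usual constant. The three
  parts have the form in which \<open>killed_step_integrand\<close> uses them.
\<close>

lemma entrance_density_amplitude:
  assumes b: "0 < b"
  shows "integrable lborel (\<lambda>u. 1 / (2 * pi) * (exp (- (b * u\<^sup>2) / 2) * u))"
    and "z \<le> 0 \<Longrightarrow> entrance_density b z = 0"
    and "0 < z \<Longrightarrow> entrance_density b z =
      (LBINT u. 1 / (2 * pi) * (exp (- (b * u\<^sup>2) / 2) * u) * sin (u * z))"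
proof -
  show "integrable lborel (\<lambda>u. 1 / (2 * pi) * (exp (- (b * u\<^sup>2) / 2) * u))"
    using integrable_gaussian_power[OF b, of 1] by simp
  show "entrance_density b z = 0" if "z \<le> 0"
    using that by (simp add: entrance_density_def)
  show "entrance_density b z = (LBINT u. 1 / (2 * pi) * (exp (- (b * u\<^sup>2) / 2) * u) * sin (u * z))"
    if "0 < z"
    using entrance_density_eq_sine[OF b that]
    unfolding mult.assoc[of "1 / (2 * pi)"] integral_mult_right_zero .
qed

lemma killed_density_amplitude:
  assumes b: "0 < b" and y: "0 < y"
  shows "integrable lborel (\<lambda>u. 1 / pi * (exp (- (b * u\<^sup>2) / 2) * sin (u * y)))"
    and "z \<le> 0 \<Longrightarrow> killed_density b y z = 0"
    and "0 < z \<Longrightarrow> killed_density b y z =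
      (LBINT u. 1 / pi * (exp (- (b * u\<^sup>2) / 2) * sin (u * y)) * sin (u * z))"
proof -
  show "integrable lborel (\<lambda>u. 1 / pi * (exp (- (b * u\<^sup>2) / 2) * sin (u * y)))"
  proof (rule integrable_mult_right, rule Bochner_Integration.integrable_bound)
    show "integrable lborel (\<lambda>u. exp (- (b * u\<^sup>2) / 2) * u ^ 0)"
      using b by (rule integrable_gaussian_power)
  qed (auto simp: abs_mult intro!: mult_left_le)
  show "killed_density b y z = 0" if "z \<le> 0"
    using that by (simp add: killed_density_def)
  show "killed_density b y z = (LBINT u. 1 / pi * (exp (- (b * u\<^sup>2) / 2) * sin (u * y)) * sin (u * z))"
    if "0 < z"
    using killed_density_eq_sine[OF b y that]
    unfolding mult.assoc[of "1 / pi"] integral_mult_right_zero .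
qed

lemma sine_transform_bound:
  fixes b :: "real \<Rightarrow> real"
  assumes b: "integrable lborel b"
  shows "\<bar>LBINT v. b v * sin (v * z)\<bar> \<le> (LBINT v. \<bar>b v\<bar>)"
proof -
  note [measurable] = borel_measurable_integrable[OF b]
  have "integrable lborel (\<lambda>v. b v * sin (v * z))"
    by (rule Bochner_Integration.integrable_bound[OF b]) (auto simp: abs_mult intro!: mult_left_le)
  then have "(LBINT v. \<bar>b v * sin (v * z)\<bar>) \<le> (LBINT v. \<bar>b v\<bar>)"
    using b by (intro integral_mono integrable_abs) (auto simp: abs_mult intro!: mult_left_le)
  with integral_abs_bound[of lborel "\<lambda>v. b v * sin (v * z)"] show ?thesis
    by (rule order_trans)
qed

text \<open>
  Sine transforms of integrable functions are bounded, so that the damping factor alone gives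
  integrability.
\<close>

lemma integrable_damped_sine_product:
  fixes a b :: "real \<Rightarrow> real"
  assumes s: "0 < s" and a: "integrable lborel a" and b: "integrable lborel b"
  shows "integrable lborel (\<lambda>z. indicator {0<..} z * exp (- (s * z)) *
      (LBINT u. a u * sin (u * z)) * (LBINT v. b v * sin (v * z)))"
proof -
  note [measurable] = borel_measurable_integrable[OF a] borel_measurable_integrable[OF b]
  let ?C = "(LBINT u. \<bar>a u\<bar>) * (LBINT v. \<bar>b v\<bar>)"
  have "integrable lborel (\<lambda>z. indicator {0<..} z * exp (- (s * z)) * ?C)"
    using integrable_exp_halfline[OF s] by simp
  then show ?thesis
  proof (rule Bochner_Integration.integrable_bound, goal_cases)
    case 2
    have "\<bar>(LBINT u. a u * sin (u * z)) * (LBINT v. b v * sin (v * z))\<bar> \<le> \<bar>?C\<bar>" for z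
      using sine_transform_bound[OF a, of z] sine_transform_bound[OF b, of z]
      unfolding abs_mult by (intro mult_mono) auto
    then show ?case
      unfolding mult.assoc real_norm_def abs_mult[of "indicator _ _"] abs_mult[of "exp _"]
      by (intro AE_I2 mult_left_mono) auto
  qed measurable
qed

text \<open>
  The damped inner product of two sine transforms, expressed through their amplitudes: this is
  Fubini's theorem, applied once for each amplitude, followed by \<open>laplace_sin_sin\<close>.
\<close>

lemma parseval_damped_sine:
  fixes a b :: "real \<Rightarrow> real"
  assumes s: "0 < s" and a: "integrable lborel a" and b: "integrable lborel b"
  shows "(LBINT z. indicator {0<..} z * exp (- (s * z)) *
      (LBINT u. a u * sin (u * z)) * (LBINT v. b v * sin (v * z))) =
    (LBINT u. a u * (LBINT v. b v *
      (2 * s * u * v / ((v\<^sup>2 - u\<^sup>2)\<^sup>2 + 2 * (u\<^sup>2 + v\<^sup>2) * s\<^sup>2 + s ^ 4))))"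
proof -
  note [measurable] = borel_measurable_integrable[OF a] borel_measurable_integrable[OF b]
  let ?e = "\<lambda>z. indicator {0<..} z * exp (- (s * z)) :: real"
  \<comment> \<open>One exchange of integrals, for a bounded function \<open>g\<close> of the damped variable \<open>z\<close>;
  it is used with \<open>g\<close> the other transform and then with \<open>g\<close> a sine.\<close>
  have swap: "(LBINT z. LBINT u. ?e z * g z * (f u * sin (u * z))) =
      (LBINT u. f u * (LBINT z. ?e z * g z * sin (u * z)))"
    if f: "integrable lborel f" and [measurable]: "g \<in> borel_measurable borel" and g: "\<And>z. \<bar>g z\<bar> \<le> C"
    for f g :: "real \<Rightarrow> real" and C
  proof -
    note [measurable] = borel_measurable_integrable[OF f]
    have "integrable (lborel \<Otimes>\<^sub>M lborel) (\<lambda>(u, z). f u * (C * ?e z))"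
    proof (rule lborel_pair.Fubini_integrable)
      show "integrable lborel (\<lambda>u. LBINT z. norm (case (u, z) of (u, z) \<Rightarrow> f u * (C * ?e z)))"
        using f by (simp add: abs_mult)
      show "AE u in lborel. integrable lborel (\<lambda>z. case (u, z) of (u, z) \<Rightarrow> f u * (C * ?e z))"
        using integrable_exp_halfline[OF s] by auto
    qed measurable
    then have "integrable (lborel \<Otimes>\<^sub>M lborel) (\<lambda>(u, z). ?e z * g z * (f u * sin (u * z)))"
    proof (rule Bochner_Integration.integrable_bound, goal_cases)
      case 2
      have "0 \<le> C" using g[of 0] by linarith
      have "\<bar>?e z * g z * (f u * sin (u * z))\<bar> \<le> \<bar>f u * (C * ?e z)\<bar>" for u z
      proof -
        have "\<bar>?e z * g z * (f u * sin (u * z))\<bar> = \<bar>f u\<bar> * ((\<bar>g z\<bar> * \<bar>sin (u * z)\<bar>) * ?e z)"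
          by (simp add: abs_mult)
        also have "\<dots> \<le> \<bar>f u\<bar> * ((C * 1) * ?e z)"
          using g[of z] \<open>0 \<le> C\<close> by (intro mult_left_mono mult_right_mono mult_mono) auto
        finally show ?thesis using \<open>0 \<le> C\<close> by (simp add: abs_mult)
      qed
      then show ?case by auto
    qed measurable
    then have "(LBINT z. LBINT u. ?e z * g z * (f u * sin (u * z))) =
        (LBINT u. LBINT z. ?e z * g z * (f u * sin (u * z)))"
      by (rule lborel_pair.Fubini_integral)
    also have "\<dots> = (LBINT u. f u * (LBINT z. ?e z * g z * sin (u * z)))"
      by (intro Bochner_Integration.integral_cong refl, subst integral_mult_right_zero[symmetric])
         (simp only: ac_simps)
    finally show ?thesis .
  qed
  have "(LBINT z. ?e z * (LBINT u. a u * sin (u * z)) * (LBINT v. b v * sin (v * z))) =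
      (LBINT z. LBINT u. ?e z * (LBINT v. b v * sin (v * z)) * (a u * sin (u * z)))"
    by (simp only: integral_mult_right_zero) (simp only: ac_simps)
  also have "\<dots> = (LBINT u. a u * (LBINT z. ?e z * (LBINT v. b v * sin (v * z)) * sin (u * z)))"
    by (rule swap[OF a _ sine_transform_bound[OF b]]) measurable
  also have "(\<lambda>u. LBINT z. ?e z * (LBINT v. b v * sin (v * z)) * sin (u * z)) =
      (\<lambda>u. LBINT v. b v * (LBINT z. ?e z * (sin (u * z) * sin (v * z))))"
  proof
    fix u
    have "(LBINT z. ?e z * (LBINT v. b v * sin (v * z)) * sin (u * z)) =
        (LBINT z. LBINT v. ?e z * sin (u * z) * (b v * sin (v * z)))"
      by (simp only: integral_mult_right_zero) (simp only: ac_simps)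
    also have "\<dots> = (LBINT v. b v * (LBINT z. ?e z * sin (u * z) * sin (v * z)))"
      by (rule swap[OF b, where C = 1]) auto
    finally show "(LBINT z. ?e z * (LBINT v. b v * sin (v * z)) * sin (u * z)) =
        (LBINT v. b v * (LBINT z. ?e z * (sin (u * z) * sin (v * z))))"
      by (simp only: mult.assoc)
  qed
  also have "(LBINT u. a u * (LBINT v. b v * (LBINT z. ?e z * (sin (u * z) * sin (v * z))))) =
    (LBINT u. a u * (LBINT v. b v *
      (2 * s * u * v / ((v\<^sup>2 - u\<^sup>2)\<^sup>2 + 2 * (u\<^sup>2 + v\<^sup>2) * s\<^sup>2 + s ^ 4))))"
    by (simp only: laplace_sin_sin[OF s])
  finally show ?thesis .
qed

section \<open>The transition density after the substitution \<open>x = u\<^sup>2\<close>\<close>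

lemma nn_integral_square_substitution_halfline:
  fixes f :: "real \<Rightarrow> ennreal"
  assumes [measurable]: "f \<in> borel_measurable borel"
  shows "(\<integral>\<^sup>+x. f x * indicator {0..} x \<partial>lborel) =
    (\<integral>\<^sup>+u. f (u\<^sup>2) * ennreal (2 * u) * indicator {0..} u \<partial>lborel)"
proof -
  \<comment> \<open>The substitution rule is applied on \<open>[0, n + 1]\<close>; both sides increase to the integrals over the half line.\<close>
  define m where "m n = real (Suc n)" for n
  have ev: "eventually (\<lambda>n. x \<le> m n) sequentially" for x
    unfolding m_def by real_asymp
  have mono: "m i \<le> m j" "(m i)\<^sup>2 \<le> (m j)\<^sup>2" if "i \<le> j" for i j
    using that by (auto simp: m_def intro!: power_mono)
  have eq: "(\<integral>\<^sup>+x. f x * indicator {0..(m n)\<^sup>2} x \<partial>lborel) =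
      (\<integral>\<^sup>+u. f (u\<^sup>2) * ennreal (2 * u) * indicator {0..m n} u \<partial>lborel)" for n
  proof -
    have "((\<lambda>u. u\<^sup>2) has_real_derivative 2 * u) (at u)" for u :: real
      by (auto intro!: derivative_eq_intros)
    from nn_integral_substitution_aux[OF assms _ this, of 0 "m n"] show ?thesis
      by (auto simp: m_def intro!: continuous_intros)
  qed
  have "(\<lambda>n. \<integral>\<^sup>+x. f x * indicator {0..(m n)\<^sup>2} x \<partial>lborel) \<longlonglongrightarrow>
      (\<integral>\<^sup>+x. f x * indicator {0..} x \<partial>lborel)"
  proof (rule nn_integral_LIMSEQ)
    show "incseq (\<lambda>n x. f x * indicator {0..(m n)\<^sup>2} x)"
      using mono(2) by (auto simp: incseq_def le_fun_def split: split_indicator intro: order_trans)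
    fix x
    have "eventually (\<lambda>n. x \<le> (m n)\<^sup>2) sequentially"
      unfolding m_def by real_asymp
    then show "(\<lambda>n. f x * indicator {0..(m n)\<^sup>2} x) \<longlonglongrightarrow> f x * indicator {0..} x"
      by (intro tendsto_eventually, elim eventually_mono) (auto split: split_indicator)
  qed measurable
  moreover have "(\<lambda>n. \<integral>\<^sup>+u. f (u\<^sup>2) * ennreal (2 * u) * indicator {0..m n} u \<partial>lborel) \<longlonglongrightarrow>
      (\<integral>\<^sup>+u. f (u\<^sup>2) * ennreal (2 * u) * indicator {0..} u \<partial>lborel)"
  proof (rule nn_integral_LIMSEQ)
    show "incseq (\<lambda>n u. f (u\<^sup>2) * ennreal (2 * u) * indicator {0..m n} u)"
      using mono(1) by (auto simp: incseq_def le_fun_def split: split_indicator intro: order_trans)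
    fix u
    show "(\<lambda>n. f (u\<^sup>2) * ennreal (2 * u) * indicator {0..m n} u) \<longlonglongrightarrow>
        f (u\<^sup>2) * ennreal (2 * u) * indicator {0..} u"
      using ev[of u] by (intro tendsto_eventually, elim eventually_mono) (auto split: split_indicator)
  qed measurable
  ultimately show ?thesis unfolding eq by (rule LIMSEQ_unique)
qed

text \<open>
  The whole line covers \<open>[0, \<infinity>)\<close> twice under \<open>u \<mapsto> u\<^sup>2\<close>, which turns the Jacobian \<open>2 u\<close> of the
  half line into \<open>\<bar>u\<bar>\<close>.
\<close>

lemma nn_integral_square_substitution:
  fixes f :: "real \<Rightarrow> ennreal"
  assumes [measurable]: "f \<in> borel_measurable borel"
  shows "(\<integral>\<^sup>+x. f x * indicator {0..} x \<partial>lborel) = (\<integral>\<^sup>+u. f (u\<^sup>2) * ennreal \<bar>u\<bar> \<partial>lborel)"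
proof -
  let ?h = "\<lambda>u. f (u\<^sup>2) * ennreal \<bar>u\<bar>"
  have neg: "(\<integral>\<^sup>+u. ?h u * indicator {..<0} u \<partial>lborel) = (\<integral>\<^sup>+u. ?h u * indicator {0..} u \<partial>lborel)"
  proof -
    have "(\<integral>\<^sup>+u. ?h u * indicator {..<0} u \<partial>lborel) = (\<integral>\<^sup>+u. ?h u * indicator {0<..} u \<partial>lborel)"
      by (subst nn_integral_real_affine[where c = "-1" and t = 0], measurable)
         (simp add: indicator_def)
    also have "\<dots> = (\<integral>\<^sup>+u. ?h u * indicator {0..} u \<partial>lborel)"
      by (intro nn_integral_cong) (auto simp: indicator_def)
    finally show ?thesis .
  qed
  have "(\<integral>\<^sup>+u. ?h u \<partial>lborel) = (\<integral>\<^sup>+u. ?h u * indicator {0..} u + ?h u * indicator {..<0} u \<partial>lborel)"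
    by (intro nn_integral_cong) (auto split: split_indicator)
  also have "\<dots> = (\<integral>\<^sup>+u. ?h u * indicator {0..} u \<partial>lborel) + (\<integral>\<^sup>+u. ?h u * indicator {0..} u \<partial>lborel)"
    by (subst nn_integral_add, measurable) (simp only: neg)
  also have "\<dots> = (\<integral>\<^sup>+u. ?h u * indicator {0..} u + ?h u * indicator {0..} u \<partial>lborel)"
    by (rule nn_integral_add[symmetric]) measurable
  also have "\<dots> = (\<integral>\<^sup>+u. f (u\<^sup>2) * ennreal (2 * u) * indicator {0..} u \<partial>lborel)"
  proof (rule nn_integral_cong)
    fix u :: real
    have "ennreal (2 * u) = ennreal u + ennreal u" if "0 \<le> u"
      using that by (simp flip: ennreal_plus)
    then show "?h u * indicator {0..} u + ?h u * indicator {0..} u =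
        f (u\<^sup>2) * ennreal (2 * u) * indicator {0..} u"
      by (cases "0 \<le> u") (simp_all add: distrib_left)
  qed
  finally show ?thesis by (simp only: nn_integral_square_substitution_halfline[OF assms])
qed

text \<open>
  When the integral diverges, both sides are \<open>0\<close>. This lets identities between integrals of
  nonnegative functions be proved for \<open>\<integral>\<^sup>+\<close> and then be transferred.
\<close>

lemma lborel_integral_halfline_eq_enn2real:
  fixes f :: "real \<Rightarrow> real"
  assumes [measurable]: "f \<in> borel_measurable borel" and f: "\<And>x. 0 \<le> x \<Longrightarrow> 0 \<le> f x"
  shows "(LBINT x:{0..}. f x) = enn2real (\<integral>\<^sup>+x. ennreal (f x) * indicator {0..} x \<partial>lborel)"
proof -
  have "(LBINT x:{0..}. f x) = enn2real (\<integral>\<^sup>+x. ennreal (indicator {0..} x *\<^sub>R f x) \<partial>lborel)"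
    unfolding set_lebesgue_integral_def using f
    by (intro integral_eq_nn_integral) (auto split: split_indicator)
  also have "(\<integral>\<^sup>+x. ennreal (indicator {0..} x *\<^sub>R f x) \<partial>lborel) =
      (\<integral>\<^sup>+x. ennreal (f x) * indicator {0..} x \<partial>lborel)"
    by (intro nn_integral_cong) (simp add: indicator_def)
  finally show ?thesis .
qed

lemma lborel_integral_square_substitution:
  fixes f :: "real \<Rightarrow> real"
  assumes [measurable]: "f \<in> borel_measurable borel" and f: "\<And>x. 0 \<le> x \<Longrightarrow> 0 \<le> f x"
  shows "(LBINT x:{0..}. f x) = (LBINT u. f (u\<^sup>2) * \<bar>u\<bar>)"
proof -
  have "(LBINT x:{0..}. f x) = enn2real (\<integral>\<^sup>+x. ennreal (f x) * indicator {0..} x \<partial>lborel)"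
    using assms by (rule lborel_integral_halfline_eq_enn2real)
  also have "(\<integral>\<^sup>+x. ennreal (f x) * indicator {0..} x \<partial>lborel) =
      (\<integral>\<^sup>+u. ennreal (f (u\<^sup>2)) * ennreal \<bar>u\<bar> \<partial>lborel)"
    by (rule nn_integral_square_substitution) measurable
  also have "\<dots> = (\<integral>\<^sup>+u. ennreal (f (u\<^sup>2) * \<bar>u\<bar>) \<partial>lborel)"
    using f by (intro nn_integral_cong) (simp add: ennreal_mult)
  also have "enn2real \<dots> = (LBINT u. f (u\<^sup>2) * \<bar>u\<bar>)"
    using f by (intro integral_eq_nn_integral[symmetric]) auto
  finally show ?thesis .
qed

lemma trans_denominator_pos:
  fixes t x y :: real
  assumes "0 < t" "0 \<le> x" "0 \<le> y"
  shows "0 < (y - x)\<^sup>2 + 2 * (x + y) * t\<^sup>2 + t ^ 4"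
  using assms by (intro add_nonneg_pos add_nonneg_nonneg mult_nonneg_nonneg) auto

lemma trans_density_nonneg:
  assumes "0 < t" "0 \<le> x" "0 \<le> y"
  shows "0 \<le> trans_density t x y"
  unfolding trans_density_def using assms trans_denominator_pos[OF assms]
  by (intro divide_nonneg_nonneg mult_nonneg_nonneg) auto

lemma measurable_trans_density [measurable]:
  assumes [measurable]: "f \<in> borel_measurable N" "g \<in> borel_measurable N"
  shows "(\<lambda>w. trans_density t (f w) (g w)) \<in> borel_measurable N"
  unfolding trans_density_def by measurable

lemma measurable_entrance_density [measurable]:
  assumes [measurable]: "f \<in> borel_measurable N"
  shows "(\<lambda>w. entrance_density t (f w)) \<in> borel_measurable N"
  unfolding entrance_density_def by measurable

lemma measurable_killed_density [measurable]:
  assumes [measurable]: "f \<in> borel_measurable N" "g \<in> borel_measurable N"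
  shows "(\<lambda>w. killed_density t (f w) (g w)) \<in> borel_measurable N"
  unfolding killed_density_def indicator_times fst_conv snd_conv by measurable

text \<open>
  The process is reversible with respect to the measure \<open>\<surd>x dx\<close>.
\<close>

lemma trans_density_detailed_balance:
  "sqrt x * trans_density t x y = sqrt y * trans_density t y x"
  by (simp add: trans_density_def power2_commute[of x y] add.commute[of x y])

text \<open>
  With \<open>A = t\<^sup>2 + (v - r)\<^sup>2\<close> and \<open>B = t\<^sup>2 + (v + r)\<^sup>2\<close>, the integrand is
  \<open>t v / (\<pi> r) \<cdot> (1 / A - 1 / B)\<close>, which has an explicit primitive. It vanishes at \<open>0\<close>. At infinity the
  logarithms cancel and the two arctangents give \<open>1\<close>.
\<close>

lemma nn_integral_trans_density_pos:
  assumes t: "0 < t" and r: "0 < r"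
  shows "(\<integral>\<^sup>+v. ennreal (trans_density t (r\<^sup>2) (v\<^sup>2) * (2 * v)) * indicator {0..} v \<partial>lborel) = 1"
proof -
  let ?A = "\<lambda>v. t\<^sup>2 + (v - r)\<^sup>2" and ?B = "\<lambda>v. t\<^sup>2 + (v + r)\<^sup>2"
  let ?F = "\<lambda>v. 1 / (pi * r) * (t / 2 * (ln (?A v) - ln (?B v)) +
      r * (arctan ((v - r) / t) + arctan ((v + r) / t)))"
  have A: "0 < ?A v" and B: "0 < ?B v" for v using t by (auto simp: add_pos_nonneg)
  have D: "(v\<^sup>2 - r\<^sup>2)\<^sup>2 + 2 * (r\<^sup>2 + v\<^sup>2) * t\<^sup>2 + t ^ 4 = ?A v * ?B v" for v by algebra
  have "(\<integral>\<^sup>+v. ennreal (trans_density t (r\<^sup>2) (v\<^sup>2) * (2 * v)) * indicator {0..} v \<partial>lborel) =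
      ennreal (1 - ?F 0)"
  proof (rule nn_integral_FTC_atLeast)
    fix v :: real assume v: "0 \<le> v"
    have arc: "((\<lambda>v. arctan ((v + q) / t)) has_real_derivative t * (1 / (t\<^sup>2 + (v + q)\<^sup>2))) (at v)" for q
    proof -
      have "0 < t\<^sup>2 + (v + q)\<^sup>2" using t by (simp add: add_pos_nonneg)
      moreover have "1 + ((v + q) / t)\<^sup>2 = (t\<^sup>2 + (v + q)\<^sup>2) / t\<^sup>2" using t by (simp add: field_simps)
      ultimately show ?thesis
        using t by (auto intro!: derivative_eq_intros simp: power2_eq_square)
    qed
    have log: "((\<lambda>v. ln (t\<^sup>2 + (v + q)\<^sup>2)) has_real_derivative 2 * (v + q) * (1 / (t\<^sup>2 + (v + q)\<^sup>2))) (at v)" for q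
    proof -
      have "0 < t\<^sup>2 + (v + q)\<^sup>2" using t by (simp add: add_pos_nonneg)
      then show ?thesis by (auto intro!: derivative_eq_intros simp: divide_inverse)
    qed
    have "(?F has_real_derivative 1 / (pi * r) *
        (t / 2 * (2 * (v - r) * (1 / ?A v) - 2 * (v + r) * (1 / ?B v)) +
        r * (t * (1 / ?A v) + t * (1 / ?B v)))) (at v)"
      by (intro DERIV_cmult DERIV_add DERIV_diff arc log arc[of "- r", unfolded add_uminus_conv_diff]
          log[of "- r", unfolded add_uminus_conv_diff])
    also have "t / 2 * (2 * (v - r) * a - 2 * (v + r) * b) + r * (t * a + t * b) = t * v * (a - b)" for a b
      by (simp add: field_simps)
    also have "1 / ?A v - 1 / ?B v = 4 * v * r / (?A v * ?B v)"
    proof -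
      have "1 / ?A v - 1 / ?B v = (1 * ?B v - 1 * ?A v) / (?A v * ?B v)"
        using A[of v] B[of v] by (intro diff_frac_eq) auto
      also have "1 * ?B v - 1 * ?A v = 4 * v * r" by algebra
      finally show ?thesis .
    qed
    also have "1 / (pi * r) * (t * v * (4 * v * r / (?A v * ?B v))) = trans_density t (r\<^sup>2) (v\<^sup>2) * (2 * v)"
      using r v unfolding trans_density_def D by simp
    finally show "(?F has_real_derivative trans_density t (r\<^sup>2) (v\<^sup>2) * (2 * v)) (at v)" .
    show "0 \<le> trans_density t (r\<^sup>2) (v\<^sup>2) * (2 * v)"
      using t v by (intro mult_nonneg_nonneg trans_density_nonneg) auto
  next
    show "(?F \<longlongrightarrow> 1) at_top" using t r by real_asymp
  qed measurable
  also have "?F 0 = 0" by (simp add: arctan_minus)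
  finally show ?thesis by simp
qed

text \<open>
  The primitive used for \<open>r > 0\<close> degenerates at \<open>r = 0\<close>, so that the starting point \<open>0\<close> has its own.
\<close>

lemma nn_integral_trans_density_zero:
  assumes t: "0 < t"
  shows "(\<integral>\<^sup>+v. ennreal (trans_density t 0 (v\<^sup>2) * (2 * v)) * indicator {0..} v \<partial>lborel) = 1"
proof -
  let ?F = "\<lambda>v. 2 / pi * (arctan (v / t) - t * v / (t\<^sup>2 + v\<^sup>2))"
  have "(\<integral>\<^sup>+v. ennreal (trans_density t 0 (v\<^sup>2) * (2 * v)) * indicator {0..} v \<partial>lborel) =
      ennreal (1 - ?F 0)"
  proof (rule nn_integral_FTC_atLeast)
    fix v :: real assume v: "0 \<le> v"
    have A: "0 < t\<^sup>2 + v\<^sup>2" using t by (simp add: add_pos_nonneg)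
    have arc: "((\<lambda>v. arctan (v / t)) has_real_derivative t / (t\<^sup>2 + v\<^sup>2)) (at v)"
    proof -
      have "1 + (v / t)\<^sup>2 = (t\<^sup>2 + v\<^sup>2) / t\<^sup>2" using t by (simp add: field_simps)
      then show ?thesis
        using t A by (auto intro!: derivative_eq_intros simp: power2_eq_square)
    qed
    have "(?F has_real_derivative 2 / pi * (t / (t\<^sup>2 + v\<^sup>2) -
        (t * (t\<^sup>2 + v\<^sup>2) - t * v * (2 * v)) / (t\<^sup>2 + v\<^sup>2)\<^sup>2)) (at v)"
    proof (intro DERIV_cmult DERIV_diff arc)
      show "((\<lambda>v. t * v / (t\<^sup>2 + v\<^sup>2)) has_real_derivative
          (t * (t\<^sup>2 + v\<^sup>2) - t * v * (2 * v)) / (t\<^sup>2 + v\<^sup>2)\<^sup>2) (at v)"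
        using A by (auto intro!: derivative_eq_intros simp: power2_eq_square)
    qed
    also have "t / (t\<^sup>2 + v\<^sup>2) = t * (t\<^sup>2 + v\<^sup>2) / (t\<^sup>2 + v\<^sup>2)\<^sup>2"
      using A by (simp add: power2_eq_square)
    also have "2 / pi * (t * (t\<^sup>2 + v\<^sup>2) / (t\<^sup>2 + v\<^sup>2)\<^sup>2 -
        (t * (t\<^sup>2 + v\<^sup>2) - t * v * (2 * v)) / (t\<^sup>2 + v\<^sup>2)\<^sup>2) = trans_density t 0 (v\<^sup>2) * (2 * v)"
    proof -
      have "(v\<^sup>2 - 0)\<^sup>2 + 2 * (0 + v\<^sup>2) * t\<^sup>2 + t ^ 4 = (t\<^sup>2 + v\<^sup>2)\<^sup>2" by algebra
      then show ?thesis
        using v unfolding trans_density_def by (simp add: diff_divide_distrib[symmetric])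
    qed
    finally show "(?F has_real_derivative trans_density t 0 (v\<^sup>2) * (2 * v)) (at v)" .
    show "0 \<le> trans_density t 0 (v\<^sup>2) * (2 * v)"
      using t v by (intro mult_nonneg_nonneg trans_density_nonneg) auto
  next
    show "(?F \<longlongrightarrow> 1) at_top" using t by real_asymp
  qed measurable
  then show ?thesis by simp
qed

lemma nn_integral_trans_density:
  assumes t: "0 < t" and x: "0 \<le> x"
  shows "(\<integral>\<^sup>+y. ennreal (trans_density t x y * indicator {0..} y) \<partial>lborel) = 1"
proof -
  have "(\<integral>\<^sup>+y. ennreal (trans_density t x y * indicator {0..} y) \<partial>lborel) =
      (\<integral>\<^sup>+y. ennreal (trans_density t x y) * indicator {0..} y \<partial>lborel)"
    by (intro nn_integral_cong) (auto split: split_indicator)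
  also have "\<dots> = (\<integral>\<^sup>+v. ennreal (trans_density t x (v\<^sup>2)) * ennreal (2 * v) * indicator {0..} v \<partial>lborel)"
    by (rule nn_integral_square_substitution_halfline) measurable
  also have "\<dots> = (\<integral>\<^sup>+v. ennreal (trans_density t ((sqrt x)\<^sup>2) (v\<^sup>2) * (2 * v)) * indicator {0..} v \<partial>lborel)"
    using x trans_density_nonneg[OF t x]
    by (intro nn_integral_cong) (auto split: split_indicator simp: ennreal_mult)
  also have "\<dots> = 1"
  proof (cases "x = 0")
    case True
    then show ?thesis using nn_integral_trans_density_zero[OF t] by simp
  next
    case False
    then show ?thesis using nn_integral_trans_density_pos[OF t, of "sqrt x"] x by simp
  qed
  finally show ?thesis .
qed

lemma nn_integral_trans_prob:
  assumes [measurable]: "f \<in> borel_measurable borel"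
  shows "(\<integral>\<^sup>+y. f y \<partial>trans_prob t x) =
    (\<integral>\<^sup>+y. ennreal (trans_density t x y * indicator {0..} y) * f y \<partial>lborel)"
  unfolding trans_prob_def by (subst nn_integral_density) auto

lemma prob_space_trans_prob:
  assumes "0 < t" "0 \<le> x"
  shows "prob_space (trans_prob t x)"
proof
  show "emeasure (trans_prob t x) (space (trans_prob t x)) = 1"
    using nn_integral_trans_density[OF assms]
    unfolding trans_prob_def by (simp add: emeasure_density)
qed

lemma sets_trans_prob [simp, measurable_cong]: "sets (trans_prob t x) = sets borel"
  by (simp add: trans_prob_def)

lemma space_trans_prob [simp]: "space (trans_prob t x) = UNIV"
  by (simp add: trans_prob_def)

section \<open>The iterated integrals of the two chains\<close>

text \<open>
  \<open>dual_laplace c s m j x\<close> is the conditional expectation, given that the process is at \<open>x\<close> at step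
  \<open>j\<close>, of the factors \<open>exp (- c k x\<^sub>k / 2)\<close> for the steps \<open>k = j, \<dots>, j + m\<close>, where the process runs for
  a time \<open>s k\<close> before step \<open>k\<close>. The index \<open>j\<close> is carried along because \<open>c\<close> and \<open>s\<close> are fixed, while the recursion
  peels off the first step.
\<close>

fun dual_laplace :: "(nat \<Rightarrow> real) \<Rightarrow> (nat \<Rightarrow> real) \<Rightarrow> nat \<Rightarrow> nat \<Rightarrow> real \<Rightarrow> real" where
  "dual_laplace c s 0 j x = exp (- (c j * x) / 2)"
| "dual_laplace c s (Suc m) j x = exp (- (c j * x) / 2) *
     (LBINT y:{0..}. trans_density (s (Suc j)) x y * dual_laplace c s m (Suc j) y)"

text \<open>
  The corresponding integral for the excursion, with the roles of \<open>c\<close> and \<open>s\<close> exchanged: from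
  position \<open>y\<close> at step \<open>j\<close>, the motion runs for a time \<open>c k\<close> after each step \<open>k\<close>, is weighted by
  \<open>exp (- s k y\<^sub>k)\<close> at the steps \<open>k = j + 1, \<dots>, j + m\<close>, and finally returns to \<open>0\<close>.
\<close>

fun killed_laplace :: "(nat \<Rightarrow> real) \<Rightarrow> (nat \<Rightarrow> real) \<Rightarrow> nat \<Rightarrow> nat \<Rightarrow> real \<Rightarrow> real" where
  "killed_laplace c s 0 j y = entrance_density (c j) y"
| "killed_laplace c s (Suc m) j y =
     (LBINT z. killed_density (c j) y z * exp (- (s (Suc j) * z)) * killed_laplace c s m (Suc j) z)"

lemma measurable_dual_laplace [measurable]: "dual_laplace c s m j \<in> borel_measurable borel"
proof (induction m arbitrary: j)
  case 0
  show ?case unfolding dual_laplace.simps[abs_def] by measurable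
next
  case (Suc m)
  note [measurable] = Suc
  show ?case unfolding dual_laplace.simps[abs_def] set_lebesgue_integral_def by measurable
qed

lemma measurable_killed_laplace [measurable]: "killed_laplace c s m j \<in> borel_measurable borel"
proof (induction m arbitrary: j)
  case 0
  show ?case unfolding killed_laplace.simps[abs_def] by measurable
next
  case (Suc m)
  note [measurable] = Suc
  show ?case unfolding killed_laplace.simps[abs_def] by measurable
qed

text \<open>
  The increments \<open>c k\<close> of the times of the excursion are the weights on the dual side, and the rates
  \<open>s k\<close> of the Laplace transform are the running times of the dual process.
\<close>

locale laplace_chain =
  fixes n :: nat and c s :: "nat \<Rightarrow> real"
  assumes weight_nonneg: "\<And>k. k \<le> n \<Longrightarrow> 0 \<le> c k"
    and rate_pos: "\<And>k. 1 \<le> k \<Longrightarrow> k \<le> n \<Longrightarrow> 0 < s k"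
begin

abbreviation F :: "nat \<Rightarrow> nat \<Rightarrow> real \<Rightarrow> real" where "F \<equiv> dual_laplace c s"

lemma dual_laplace_nonneg: "j + m \<le> n \<Longrightarrow> 0 \<le> x \<Longrightarrow> 0 \<le> F m j x"
proof (induction m arbitrary: j x)
  case (Suc m)
  have "0 < s (Suc j)" using Suc.prems by (intro rate_pos) auto
  then show ?case
    unfolding dual_laplace.simps set_lebesgue_integral_def using Suc
    by (intro mult_nonneg_nonneg Bochner_Integration.integral_nonneg)
       (auto split: split_indicator intro!: mult_nonneg_nonneg trans_density_nonneg)
qed simp

text \<open>
  The upper bound on \<open>F\<close> ensures that the Bochner integral in the recursion is a genuine one. It is a
  hypothesis here because the bound is itself proved by induction with the help of this lemma.
\<close>

lemma dual_laplace_step_nn: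
  assumes "j + Suc m \<le> n" "0 \<le> x" and le: "\<And>y. 0 \<le> y \<Longrightarrow> F m (Suc j) y \<le> 1"
  shows "ennreal (LBINT y:{0..}. trans_density (s (Suc j)) x y * F m (Suc j) y) =
    (\<integral>\<^sup>+y. ennreal (F m (Suc j) y) \<partial>trans_prob (s (Suc j)) x)"
proof -
  have s: "0 < s (Suc j)" using assms by (intro rate_pos) auto
  note p = trans_density_nonneg[OF s \<open>0 \<le> x\<close>]
  have F: "0 \<le> F m (Suc j) y" if "0 \<le> y" for y
    using assms(1) that by (intro dual_laplace_nonneg) auto
  have eq: "ennreal (trans_density (s (Suc j)) x y * indicator {0..} y) * ennreal (F m (Suc j) y) =
      ennreal (indicator {0..} y *\<^sub>R (trans_density (s (Suc j)) x y * F m (Suc j) y))" for y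
    using p[of y] F[of y] by (simp add: ennreal_mult split: split_indicator)
  have "integrable lborel (\<lambda>y. trans_density (s (Suc j)) x y * indicator {0..} y)"
    using p nn_integral_trans_density[OF s \<open>0 \<le> x\<close>]
    by (intro integrableI_nonneg) (auto split: split_indicator)
  then have "integrable lborel
      (\<lambda>y. indicator {0..} y *\<^sub>R (trans_density (s (Suc j)) x y * F m (Suc j) y))"
  proof (rule Bochner_Integration.integrable_bound, goal_cases)
    case 2
    show ?case using p F le by (auto split: split_indicator intro!: mult_left_le)
  qed measurable
  then have "ennreal (LBINT y:{0..}. trans_density (s (Suc j)) x y * F m (Suc j) y) =
      (\<integral>\<^sup>+y. ennreal (indicator {0..} y *\<^sub>R (trans_density (s (Suc j)) x y * F m (Suc j) y)) \<partial>lborel)"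
    unfolding set_lebesgue_integral_def using p F
    by (intro nn_integral_eq_integral[symmetric]) (auto split: split_indicator)
  also have "\<dots> = (\<integral>\<^sup>+y. ennreal (F m (Suc j) y) \<partial>trans_prob (s (Suc j)) x)"
    unfolding eq[symmetric] by (rule nn_integral_trans_prob[symmetric]) measurable
  finally show ?thesis .
qed

lemma dual_laplace_le: "j + m \<le> n \<Longrightarrow> 0 \<le> x \<Longrightarrow> F m j x \<le> exp (- (c j * x) / 2)"
proof (induction m arbitrary: j x)
  case (Suc m)
  have s: "0 < s (Suc j)" using Suc.prems by (intro rate_pos) auto
  interpret K: prob_space "trans_prob (s (Suc j)) x" by (intro prob_space_trans_prob s Suc.prems)
  have le: "F m (Suc j) y \<le> 1" if "0 \<le> y" for y
    using Suc.IH[of "Suc j" y] weight_nonneg[of "Suc j"] Suc.prems(1) that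
    by (auto intro: order_trans)
  have AE: "AE y in trans_prob (s (Suc j)) x. 0 \<le> y"
    unfolding trans_prob_def by (subst AE_density) (auto split: split_indicator)
  have "(\<integral>\<^sup>+y. ennreal (F m (Suc j) y) \<partial>trans_prob (s (Suc j)) x) \<le>
      (\<integral>\<^sup>+y. 1 \<partial>trans_prob (s (Suc j)) x)"
    using AE by (intro nn_integral_mono_AE) (auto simp: le ennreal_le_1 elim!: eventually_mono)
  also have "\<dots> = 1" by (simp add: K.emeasure_space_1[simplified])
  finally have "ennreal (LBINT y:{0..}. trans_density (s (Suc j)) x y * F m (Suc j) y) \<le> 1"
    using dual_laplace_step_nn[OF Suc.prems le] by simp
  then show ?case
    unfolding dual_laplace.simps ennreal_le_1 by (rule mult_left_le) simp
qed simp

lemma dual_laplace_le_1: "j + m \<le> n \<Longrightarrow> 0 \<le> x \<Longrightarrow> F m j x \<le> 1"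
  using dual_laplace_le[of j m x] weight_nonneg[of j]
  by (auto intro: order_trans)

lemma dual_laplace_Suc_nn:
  assumes "j + Suc m \<le> n" "0 \<le> x"
  shows "ennreal (F (Suc m) j x) = ennreal (exp (- (c j * x) / 2)) *
    (\<integral>\<^sup>+y. ennreal (F m (Suc j) y) \<partial>trans_prob (s (Suc j)) x)"
  using dual_laplace_step_nn[OF assms dual_laplace_le_1] assms(1)
  by (simp add: ennreal_mult')

text \<open>
  A weight \<open>0\<close> at the last step leaves the total mass of the transition probability.
\<close>

lemma dual_laplace_drop_last:
  assumes "Suc (j + m) \<le> n" "c (Suc (j + m)) = 0" "0 \<le> x"
  shows "F (Suc m) j x = F m j x"
  using assms
proof (induction m arbitrary: j x)
  case 0
  have s: "0 < s (Suc j)" using 0 by (intro rate_pos) auto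
  interpret K: prob_space "trans_prob (s (Suc j)) x" by (intro prob_space_trans_prob s 0)
  have "ennreal (F (Suc 0) j x) = ennreal (F 0 j x)"
    using 0 by (subst dual_laplace_Suc_nn) (auto simp: K.emeasure_space_1[simplified])
  then show ?case
    using 0 dual_laplace_nonneg[of j "Suc 0" x] dual_laplace_nonneg[of j 0 x] by simp
next
  case (Suc m)
  have "F (Suc m) (Suc j) y = F m (Suc j) y" if "0 \<le> y" for y
    using Suc that by (intro Suc.IH) auto
  then have "(LBINT y:{0..}. trans_density (s (Suc j)) x y * F (Suc m) (Suc j) y) =
      (LBINT y:{0..}. trans_density (s (Suc j)) x y * F m (Suc j) y)"
    by (intro set_lebesgue_integral_cong) (auto simp del: dual_laplace.simps)
  then show ?case by (simp only: dual_laplace.simps)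
qed

text \<open>
  A weight \<open>0\<close> at the first step leaves the law \<open>\<surd>x dx\<close> transported by one step of the process, and
  this measure is invariant by reversibility.
\<close>

lemma dual_laplace_drop_first_nn:
  assumes "j + Suc m \<le> n" "c j = 0"
  shows "(\<integral>\<^sup>+x. ennreal (sqrt x * F (Suc m) j x) * indicator {0..} x \<partial>lborel) =
    (\<integral>\<^sup>+x. ennreal (sqrt x * F m (Suc j) x) * indicator {0..} x \<partial>lborel)"
proof -
  let ?p = "trans_density (s (Suc j))" and ?I = "indicator {0..} :: real \<Rightarrow> real"
  have s: "0 < s (Suc j)" using assms by (intro rate_pos) auto
  note p = trans_density_nonneg[OF s]
  have F: "0 \<le> F m (Suc j) y" if "0 \<le> y" for y
    using assms(1) that by (intro dual_laplace_nonneg) auto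
  have eq: "ennreal (sqrt x) * ennreal (?I x) * (ennreal (?p x y * ?I y) * ennreal (F m (Suc j) y)) =
      ennreal (sqrt y * F m (Suc j) y * ?I y) * ennreal (?p y x * ?I x)" for x y
  proof (cases "0 \<le> x \<and> 0 \<le> y")
    case True
    then have "sqrt x * (?p x y * F m (Suc j) y) = sqrt y * F m (Suc j) y * ?p y x"
      using trans_density_detailed_balance[of x "s (Suc j)" y] by (simp add: ac_simps)
    then show ?thesis
      using True p[of x y] p[of y x] F[of y] by (simp flip: ennreal_mult')
  qed auto
  have "(\<integral>\<^sup>+x. ennreal (sqrt x * F (Suc m) j x) * indicator {0..} x \<partial>lborel) =
      (\<integral>\<^sup>+x. ennreal (sqrt x) * ennreal (?I x) *
        (\<integral>\<^sup>+y. ennreal (?p x y * ?I y) * ennreal (F m (Suc j) y) \<partial>lborel) \<partial>lborel)"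
  proof (rule nn_integral_cong)
    fix x :: real
    show "ennreal (sqrt x * F (Suc m) j x) * indicator {0..} x = ennreal (sqrt x) * ennreal (?I x) *
        (\<integral>\<^sup>+y. ennreal (?p x y * ?I y) * ennreal (F m (Suc j) y) \<partial>lborel)"
    proof (cases "0 \<le> x")
      case True
      then show ?thesis
        using dual_laplace_Suc_nn[OF assms(1) True] assms(2)
        by (simp add: ennreal_mult' nn_integral_trans_prob del: dual_laplace.simps)
    qed auto
  qed
  also have "\<dots> = (\<integral>\<^sup>+x. \<integral>\<^sup>+y. ennreal (sqrt x) * ennreal (?I x) *
        (ennreal (?p x y * ?I y) * ennreal (F m (Suc j) y)) \<partial>lborel \<partial>lborel)"
    by (intro nn_integral_cong nn_integral_cmult[symmetric]) measurable
  also have "\<dots> = (\<integral>\<^sup>+x. \<integral>\<^sup>+y. ennreal (sqrt y * F m (Suc j) y * ?I y) * ennreal (?p y x * ?I x) \<partial>lborel \<partial>lborel)"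
    by (simp only: eq)
  also have "\<dots> = (\<integral>\<^sup>+y. \<integral>\<^sup>+x. ennreal (sqrt y * F m (Suc j) y * ?I y) * ennreal (?p y x * ?I x) \<partial>lborel \<partial>lborel)"
    by (rule lborel_pair.Fubini') measurable
  also have "\<dots> = (\<integral>\<^sup>+y. ennreal (sqrt y * F m (Suc j) y) * indicator {0..} y \<partial>lborel)"
  proof (rule nn_integral_cong)
    fix y :: real
    show "(\<integral>\<^sup>+x. ennreal (sqrt y * F m (Suc j) y * ?I y) * ennreal (?p y x * ?I x) \<partial>lborel) =
        ennreal (sqrt y * F m (Suc j) y) * indicator {0..} y"
      using nn_integral_trans_density[OF s, of y]
      by (cases "0 \<le> y") (simp_all add: nn_integral_cmult)
  qed
  finally show ?thesis .
qed

lemma dual_laplace_drop_first: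
  assumes "j + Suc m \<le> n" "c j = 0"
  shows "(LBINT x:{0..}. sqrt x * F (Suc m) j x) = (LBINT x:{0..}. sqrt x * F m (Suc j) x)"
proof -
  have "(LBINT x:{0..}. sqrt x * F k i x) =
      enn2real (\<integral>\<^sup>+x. ennreal (sqrt x * F k i x) * indicator {0..} x \<partial>lborel)" if "i + k \<le> n" for k i
    using dual_laplace_nonneg[OF that]
    by (intro lborel_integral_halfline_eq_enn2real) auto
  note this[OF assms(1)] this[of "Suc j" m]
  then show ?thesis using dual_laplace_drop_first_nn[OF assms] assms(1) by simp
qed

end

section \<open>The sine transform exchanges the two chains\<close>

text \<open>
  The kernel that \<open>parseval_damped_sine\<close> produces is the transition density in the variables \<open>u\<^sup>2\<close> and
  \<open>v\<^sup>2\<close>: multiplied by \<open>v\<close>, it equals \<open>\<pi> u p\<^sub>t(u\<^sup>2, v\<^sup>2) \<bar>v\<bar>\<close>.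
\<close>

lemma dual_kernel:
  fixes f :: "real \<Rightarrow> real"
  assumes t: "0 < t" and [measurable]: "f \<in> borel_measurable borel" and f: "\<And>x. 0 \<le> x \<Longrightarrow> 0 \<le> f x"
  shows "(LBINT v. f (v\<^sup>2) * v * (2 * t * u * v / ((v\<^sup>2 - u\<^sup>2)\<^sup>2 + 2 * (u\<^sup>2 + v\<^sup>2) * t\<^sup>2 + t ^ 4))) =
    pi * u * (LBINT y:{0..}. trans_density t (u\<^sup>2) y * f y)"
proof -
  have "f (v\<^sup>2) * v * (2 * t * u * v / ((v\<^sup>2 - u\<^sup>2)\<^sup>2 + 2 * (u\<^sup>2 + v\<^sup>2) * t\<^sup>2 + t ^ 4)) =
      pi * u * (trans_density t (u\<^sup>2) (v\<^sup>2) * f (v\<^sup>2) * \<bar>v\<bar>)" for v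
  proof -
    have "g * v * (2 * t * u * v / D) = pi * u * (2 * t * \<bar>v\<bar> / (pi * D) * g * \<bar>v\<bar>)" for g D
    proof -
      have "pi * u * (2 * t * \<bar>v\<bar> / (pi * D) * g * \<bar>v\<bar>) = 2 * t * u * g * (\<bar>v\<bar> * \<bar>v\<bar>) / D"
        by simp
      then show ?thesis by simp
    qed
    then show ?thesis unfolding trans_density_def real_sqrt_abs .
  qed
  moreover have "(LBINT y:{0..}. trans_density t (u\<^sup>2) y * f y) =
      (LBINT v. trans_density t (u\<^sup>2) (v\<^sup>2) * f (v\<^sup>2) * \<bar>v\<bar>)"
  proof (rule lborel_integral_square_substitution)
    show "0 \<le> trans_density t (u\<^sup>2) y * f y" if "0 \<le> y" for y
      using t f[OF that] that by (intro mult_nonneg_nonneg trans_density_nonneg) auto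
  qed measurable
  ultimately show ?thesis by (simp only: integral_mult_right_zero)
qed

text \<open>
  Strict positivity of the weights gives the amplitudes below a Gaussian decay.
\<close>

locale positive_laplace_chain = laplace_chain +
  assumes weight_pos: "\<And>k. k \<le> n \<Longrightarrow> 0 < c k"
begin

abbreviation A :: "nat \<Rightarrow> nat \<Rightarrow> real \<Rightarrow> real" where "A \<equiv> killed_laplace c s"

lemma integrable_dual_amplitude:
  assumes "j + m \<le> n"
  shows "integrable lborel (\<lambda>v. 1 / (2 * pi) * (F m j (v\<^sup>2) * v))"
proof (rule integrable_mult_right, rule Bochner_Integration.integrable_bound)
  show "integrable lborel (\<lambda>v. exp (- (c j * v\<^sup>2) / 2) * v ^ 1)"
    using assms weight_pos[of j] by (intro integrable_gaussian_power) auto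
  show "AE v in lborel. norm (F m j (v\<^sup>2) * v) \<le> norm (exp (- (c j * v\<^sup>2) / 2) * v ^ 1)"
    using dual_laplace_le[OF assms] dual_laplace_nonneg[OF assms]
    by (auto simp: abs_mult intro!: mult_right_mono)
qed measurable

text \<open>
  The common computation for an interior step, where \<open>g = g\<^sub>t(y, \<cdot>)\<close>, and for the first step, where
  \<open>g = \<ell>\<^sub>t\<close>: only the amplitude \<open>a\<close> of \<open>g\<close> differs.
\<close>

lemma killed_step_integrand:
  assumes "j + Suc m \<le> n"
    and A: "\<And>z. 0 < z \<Longrightarrow> A m (Suc j) z = (LBINT v. 1 / (2 * pi) * (F m (Suc j) (v\<^sup>2) * v) * sin (v * z))"
    and a: "integrable lborel a"
    and g: "\<And>z. z \<le> 0 \<Longrightarrow> g z = 0" "\<And>z. 0 < z \<Longrightarrow> g z = (LBINT u. a u * sin (u * z))"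
  shows "integrable lborel (\<lambda>z. g z * exp (- (s (Suc j) * z)) * A m (Suc j) z)" (is ?int)
    and "(LBINT z. g z * exp (- (s (Suc j) * z)) * A m (Suc j) z) =
      (LBINT u. a u * (u / 2 * (LBINT y:{0..}. trans_density (s (Suc j)) (u\<^sup>2) y * F m (Suc j) y)))" (is ?eq)
proof -
  let ?b = "\<lambda>v. 1 / (2 * pi) * (F m (Suc j) (v\<^sup>2) * v)"
  have s: "0 < s (Suc j)" using assms(1) by (intro rate_pos) auto
  have b: "integrable lborel ?b" using assms(1) by (intro integrable_dual_amplitude) auto
  have eq: "(\<lambda>z. g z * exp (- (s (Suc j) * z)) * A m (Suc j) z) = (\<lambda>z. indicator {0<..} z *
      exp (- (s (Suc j) * z)) * (LBINT u. a u * sin (u * z)) * (LBINT v. ?b v * sin (v * z)))"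
  proof
    fix z :: real
    show "g z * exp (- (s (Suc j) * z)) * A m (Suc j) z = indicator {0<..} z *
      exp (- (s (Suc j) * z)) * (LBINT u. a u * sin (u * z)) * (LBINT v. ?b v * sin (v * z))"
      by (cases "0 < z") (simp_all only: A g indicator_simps greaterThan_iff not_less, simp_all)
  qed
  show ?int unfolding eq by (rule integrable_damped_sine_product[OF s a b])
  have ker: "(LBINT v. ?b v * (2 * s (Suc j) * u * v /
        ((v\<^sup>2 - u\<^sup>2)\<^sup>2 + 2 * (u\<^sup>2 + v\<^sup>2) * (s (Suc j))\<^sup>2 + s (Suc j) ^ 4))) =
      u / 2 * (LBINT y:{0..}. trans_density (s (Suc j)) (u\<^sup>2) y * F m (Suc j) y)" for u
  proof -
    have "1 / (2 * pi) * (pi * u * i) = u / 2 * i" for i :: real by simp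
    moreover have "0 \<le> F m (Suc j) x" if "0 \<le> x" for x
      using assms(1) that by (intro dual_laplace_nonneg) auto
    note dual_kernel[OF s measurable_dual_laplace this, of u]
    ultimately show ?thesis
      by (simp only: mult.assoc[of "1 / (2 * pi)"] integral_mult_right_zero)
  qed
  show ?eq unfolding eq by (rule trans[OF parseval_damped_sine[OF s a b]]) (simp only: ker)
qed

text \<open>
  The heart of the duality. In the induction step the factor \<open>exp (- c j u\<^sup>2 / 2)\<close> comes from the
  amplitude of the killed density, and the transition of the dual process from the damping factor;
  together they are the recursion of \<open>dual_laplace\<close>.
\<close>

lemma killed_laplace_eq_sine:
  "j + m \<le> n \<Longrightarrow> 0 < y \<Longrightarrow> A m j y = (LBINT v. 1 / (2 * pi) * (F m j (v\<^sup>2) * v) * sin (v * y))"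
proof (induction m arbitrary: j y)
  case 0
  then show ?case
    using entrance_density_amplitude(3)[of "c j" y] weight_pos[of j] by simp
next
  case (Suc m)
  let ?a = "\<lambda>u. 1 / pi * (exp (- (c j * u\<^sup>2) / 2) * sin (u * y))"
  have c: "0 < c j" using Suc.prems by (intro weight_pos) auto
  have "A (Suc m) j y = (LBINT z. killed_density (c j) y z * exp (- (s (Suc j) * z)) * A m (Suc j) z)"
    by simp
  also have "\<dots> = (LBINT u. ?a u * (u / 2 *
      (LBINT y:{0..}. trans_density (s (Suc j)) (u\<^sup>2) y * F m (Suc j) y)))"
    by (rule killed_step_integrand(2)[OF Suc.prems(1) Suc.IH killed_density_amplitude[OF c Suc.prems(2)]])
       (use Suc.prems in auto)
  also have "\<dots> = (LBINT v. 1 / (2 * pi) * (F (Suc m) j (v\<^sup>2) * v) * sin (v * y))"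
  proof -
    have "1 / pi * (e * w) * (u / 2 * i) = 1 / (2 * pi) * (e * i * u) * w" for e w u i :: real
      by (simp add: field_simps)
    then show ?thesis by (simp only: dual_laplace.simps)
  qed
  finally show ?case .
qed

lemma integrable_killed_step:
  assumes "j + Suc m \<le> n"
  shows "integrable lborel (\<lambda>z. killed_density (c j) y z * exp (- (s (Suc j) * z)) * A m (Suc j) z)"
proof (cases "0 < y")
  case True
  have c: "0 < c j" using assms by (intro weight_pos) auto
  have A: "A m (Suc j) z = (LBINT v. 1 / (2 * pi) * (F m (Suc j) (v\<^sup>2) * v) * sin (v * z))"
    if "0 < z" for z
    using assms that by (intro killed_laplace_eq_sine) auto
  show ?thesis
    by (rule killed_step_integrand(1)[OF assms A killed_density_amplitude[OF c True]])
next
  case False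
  then show ?thesis by (simp add: killed_density_def)
qed

text \<open>
  Here the amplitude \<open>u exp (- c j u\<^sup>2 / 2) / (2 \<pi>)\<close> of \<open>\<ell>\<close> meets the factor \<open>u / 2\<close> of the step, so
  that the integrand contains \<open>u\<^sup>2 = \<surd>x \<cdot> \<bar>u\<bar>\<close>: the weight \<open>\<surd>x\<close> and the Jacobian.
\<close>

lemma
  assumes "j + Suc m \<le> n"
  shows integrable_entrance_killed_laplace:
      "integrable lborel (\<lambda>z. entrance_density (c j) z * exp (- (s (Suc j) * z)) * A m (Suc j) z)"
    and entrance_killed_laplace:
      "(LBINT z. entrance_density (c j) z * exp (- (s (Suc j) * z)) * A m (Suc j) z) =
        1 / (4 * pi) * (LBINT x:{0..}. sqrt x * F (Suc m) j x)"
proof -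
  have c: "0 < c j" using assms by (intro weight_pos) auto
  have A: "A m (Suc j) z = (LBINT v. 1 / (2 * pi) * (F m (Suc j) (v\<^sup>2) * v) * sin (v * z))"
    if "0 < z" for z
    using assms that by (intro killed_laplace_eq_sine) auto
  note step = killed_step_integrand[OF assms A entrance_density_amplitude[OF c]]
  show "integrable lborel (\<lambda>z. entrance_density (c j) z * exp (- (s (Suc j) * z)) * A m (Suc j) z)"
    by (rule step(1))
  have "(LBINT z. entrance_density (c j) z * exp (- (s (Suc j) * z)) * A m (Suc j) z) =
      (LBINT u. 1 / (2 * pi) * (exp (- (c j * u\<^sup>2) / 2) * u) * (u / 2 *
        (LBINT y:{0..}. trans_density (s (Suc j)) (u\<^sup>2) y * F m (Suc j) y)))"
    by (rule step(2))
  also have "\<dots> = (LBINT u. 1 / (4 * pi) * (sqrt (u\<^sup>2) * F (Suc m) j (u\<^sup>2) * \<bar>u\<bar>))"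
  proof (rule Bochner_Integration.integral_cong[OF refl])
    fix u :: real
    have "\<bar>u\<bar> * \<bar>u\<bar> = u * u" by simp
    then have "1 / (2 * pi) * (e * u) * (u / 2 * i) = 1 / (4 * pi) * (\<bar>u\<bar> * (e * i) * \<bar>u\<bar>)" for e i :: real
      by (simp add: field_simps)
    then show "1 / (2 * pi) * (exp (- (c j * u\<^sup>2) / 2) * u) * (u / 2 *
        (LBINT y:{0..}. trans_density (s (Suc j)) (u\<^sup>2) y * F m (Suc j) y)) =
        1 / (4 * pi) * (sqrt (u\<^sup>2) * F (Suc m) j (u\<^sup>2) * \<bar>u\<bar>)"
      by (simp only: dual_laplace.simps real_sqrt_abs)
  qed
  also have "\<dots> = 1 / (4 * pi) * (LBINT x:{0..}. sqrt x * F (Suc m) j x)"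
    using dual_laplace_nonneg[OF assms]
    by (subst lborel_integral_square_substitution) (auto simp del: dual_laplace.simps)
  finally show "(LBINT z. entrance_density (c j) z * exp (- (s (Suc j) * z)) * A m (Suc j) z) =
        1 / (4 * pi) * (LBINT x:{0..}. sqrt x * F (Suc m) j x)" .
qed

end

section \<open>The Laplace functional of the Markov process\<close>

lemma subalgebra_past_sigma:
  assumes "\<And>r. 0 \<le> r \<Longrightarrow> X r \<in> borel_measurable M"
  shows "subalgebra M (past_sigma M X u)"
proof -
  have "{X r -` A \<inter> space M | r A. 0 \<le> r \<and> r \<le> u \<and> A \<in> sets borel} \<subseteq> sets M"
    using assms by (auto intro: measurable_sets)
  then have "sigma_sets (space M) {X r -` A \<inter> space M | r A. 0 \<le> r \<and> r \<le> u \<and> A \<in> sets borel} \<subseteq> sets M"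
    by (rule sets.sigma_sets_subset)
  moreover have "space (past_sigma M X u) = space M"
    unfolding past_sigma_def by (rule space_measure_of) auto
  moreover have "sets (past_sigma M X u) =
      sigma_sets (space M) {X r -` A \<inter> space M | r A. 0 \<le> r \<and> r \<le> u \<and> A \<in> sets borel}"
    unfolding past_sigma_def by (rule sets_measure_of) auto
  ultimately show ?thesis unfolding subalgebra_def by simp
qed

lemma measurable_past_sigma:
  assumes "0 \<le> r" "r \<le> u"
  shows "X r \<in> borel_measurable (past_sigma M X u)"
proof (rule measurableI)
  fix A :: "real set" assume "A \<in> sets borel"
  then show "X r -` A \<inter> space (past_sigma M X u) \<in> sets (past_sigma M X u)"
    using assms unfolding past_sigma_def
    by (subst space_measure_of, blast) (auto intro!: in_measure_of)
qed simp

text \<open>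
  The Markov property of the definition, which concerns indicators of sets, extended to nonnegative
  functions of the future position and weighted by a bounded functional of the past. The positions
  lie in \<open>[0, \<infinity>)\<close>, where \<open>trans_prob\<close> is a probability measure, so that \<open>measure\<close> and \<open>emeasure\<close> agree.
\<close>

lemma markov_property_nn_integral:
  fixes f :: "real \<Rightarrow> ennreal" and G :: "'a \<Rightarrow> real"
  assumes "markov_process_from M {0..} trans_prob X x0"
    and u: "0 \<le> u" "u < v"
    and G: "G \<in> borel_measurable (past_sigma M X u)" "\<And>\<omega>. \<omega> \<in> space M \<Longrightarrow> 0 \<le> G \<omega>"
      "\<And>\<omega>. \<omega> \<in> space M \<Longrightarrow> G \<omega> \<le> 1"
    and f: "f \<in> borel_measurable borel"
  shows "(\<integral>\<^sup>+\<omega>. ennreal (G \<omega>) * f (X v \<omega>) \<partial>M) =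
    (\<integral>\<^sup>+\<omega>. ennreal (G \<omega>) * (\<integral>\<^sup>+y. f y \<partial>trans_prob (v - u) (X u \<omega>)) \<partial>M)"
proof -
  interpret markov_process_from M "{0..}" trans_prob X x0 by fact
  have sub: "subalgebra M (past_sigma M X u)"
    using process_measurable by (rule subalgebra_past_sigma)
  interpret finite_measure_subalgebra M "past_sigma M X u"
    by standard (rule sub)
  have v: "0 \<le> v" using u by simp
  note [measurable] = process_measurable[OF u(1)] process_measurable[OF v]
    measurable_from_subalg[OF sub G(1)]
  have kernel [measurable]: "(\<lambda>\<omega>. \<integral>\<^sup>+y. g y \<partial>trans_prob (v - u) (X u \<omega>)) \<in> borel_measurable M"
    if [measurable]: "g \<in> borel_measurable borel" for g :: "real \<Rightarrow> ennreal"
    unfolding nn_integral_trans_prob[OF that] by measurable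
  show ?thesis
    using f
  proof (induction f rule: borel_measurable_induct)
    case (cong f g)
    then have "f = g" by auto
    then show ?case using cong by simp
  next
    case (set A)
    then have [measurable]: "A \<in> sets borel" by simp
    let ?I = "\<lambda>\<omega>. indicator A (X v \<omega>) :: real"
    let ?K = "\<lambda>\<omega>. measure (trans_prob (v - u) (X u \<omega>)) A"
    have bounded: "integrable M (\<lambda>\<omega>. G \<omega> * ?I \<omega>)"
      by (rule integrable_const_bound[where B = 1])
         (use G in \<open>auto split: split_indicator\<close>)
    have K: "AE \<omega> in M. G \<omega> * real_cond_exp M (past_sigma M X u) ?I \<omega> = G \<omega> * ?K \<omega>"
      using process_markov[OF u set] by (rule eventually_mono) simp
    have emb: "emeasure (trans_prob (v - u) (X u \<omega>)) A = ennreal (?K \<omega>)" if "\<omega> \<in> space M" for \<omega>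
    proof -
      have "0 \<le> X u \<omega>" using process_state_space[OF u(1) that] by simp
      then interpret K: prob_space "trans_prob (v - u) (X u \<omega>)"
        using u by (intro prob_space_trans_prob) auto
      show ?thesis by (rule K.emeasure_eq_measure)
    qed
    have [measurable]: "?K \<in> borel_measurable M"
      using kernel[of "indicator A"] unfolding measure_def by simp
    have "?I \<in> borel_measurable M" by measurable
    note rce = real_cond_exp_intg[OF bounded G(1) this]
    have intK: "integrable M (\<lambda>\<omega>. G \<omega> * ?K \<omega>)"
      using rce(1) K by (subst integrable_cong_AE[symmetric]) auto
    have "(\<integral>\<^sup>+\<omega>. ennreal (G \<omega>) * indicator A (X v \<omega>) \<partial>M) = (\<integral>\<^sup>+\<omega>. ennreal (G \<omega> * ?I \<omega>) \<partial>M)"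
      using G by (intro nn_integral_cong) (auto split: split_indicator)
    also have "\<dots> = ennreal (\<integral>\<omega>. G \<omega> * ?I \<omega> \<partial>M)"
      using G bounded by (intro nn_integral_eq_integral) auto
    also have "(\<integral>\<omega>. G \<omega> * ?I \<omega> \<partial>M) = (\<integral>\<omega>. G \<omega> * ?K \<omega> \<partial>M)"
      unfolding rce(2)[symmetric] using K
      by (intro integral_cong_AE) auto
    also have "ennreal \<dots> = (\<integral>\<^sup>+\<omega>. ennreal (G \<omega> * ?K \<omega>) \<partial>M)"
      using G intK by (intro nn_integral_eq_integral[symmetric]) auto
    also have "\<dots> = (\<integral>\<^sup>+\<omega>. ennreal (G \<omega>) * (\<integral>\<^sup>+y. indicator A y \<partial>trans_prob (v - u) (X u \<omega>)) \<partial>M)"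
      using G by (intro nn_integral_cong) (simp add: emb ennreal_mult)
    finally show ?case .
  next
    case (mult f a)
    note [measurable] = mult(2)
    show ?case
      using mult by (simp add: nn_integral_cmult mult.left_commute[of _ a])
  next
    case (add f g)
    note [measurable] = add(1,3)
    show ?case
      using add by (simp add: nn_integral_add distrib_left)
  next
    case (seq U)
    note [measurable] = seq(1)
    have mono: "incseq (\<lambda>i \<omega>. ennreal (G \<omega>) * U i (X v \<omega>))"
      using seq(3) by (auto simp: incseq_def le_fun_def intro!: mult_left_mono)
    have mono': "incseq (\<lambda>i \<omega>. ennreal (G \<omega>) * (\<integral>\<^sup>+y. U i y \<partial>trans_prob (v - u) (X u \<omega>)))"
      using seq(3) by (auto simp: incseq_def le_fun_def intro!: mult_left_mono nn_integral_mono)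
    have "(\<integral>\<^sup>+\<omega>. ennreal (G \<omega>) * (SUP i. U i) (X v \<omega>) \<partial>M) =
        (\<integral>\<^sup>+\<omega>. (SUP i. ennreal (G \<omega>) * U i (X v \<omega>)) \<partial>M)"
      by (simp add: SUP_mult_left_ennreal image_comp)
    also have "\<dots> = (SUP i. \<integral>\<^sup>+\<omega>. ennreal (G \<omega>) * U i (X v \<omega>) \<partial>M)"
      using mono by (rule nn_integral_monotone_convergence_SUP) measurable
    also have "\<dots> = (SUP i. \<integral>\<^sup>+\<omega>. ennreal (G \<omega>) * (\<integral>\<^sup>+y. U i y \<partial>trans_prob (v - u) (X u \<omega>)) \<partial>M)"
      by (simp only: seq.IH)
    also have "\<dots> = (\<integral>\<^sup>+\<omega>. (SUP i. ennreal (G \<omega>) * (\<integral>\<^sup>+y. U i y \<partial>trans_prob (v - u) (X u \<omega>))) \<partial>M)"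
      using mono' by (rule nn_integral_monotone_convergence_SUP[symmetric]) measurable
    also have "\<dots> = (\<integral>\<^sup>+\<omega>. ennreal (G \<omega>) * (\<integral>\<^sup>+y. (SUP i. U i y) \<partial>trans_prob (v - u) (X u \<omega>)) \<partial>M)"
      using seq(1,3)
      by (subst nn_integral_monotone_convergence_SUP)
         (auto simp: SUP_mult_left_ennreal measurable_cong_sets[OF sets_trans_prob refl])
    finally show ?case by (simp add: image_comp)
  qed
qed

context laplace_chain
begin

text \<open>
  The process is integrated out from its last position backwards: replacing the last factors by
  \<open>dual_laplace\<close>, the expectation does not depend on how many positions are left.
\<close>

lemma markov_laplace_functional:
  fixes S :: "nat \<Rightarrow> real"
  assumes "markov_process_from M {0..} trans_prob X x0" "0 \<le> x0"
    and S0: "S 0 = 0" and S: "\<And>k. k < n \<Longrightarrow> S (Suc k) = S k + s (Suc k)"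
  shows "(\<integral>\<omega>. exp (- (1 / 2) * (\<Sum>k=0..n. c k * X (S k) \<omega>)) \<partial>M) = F n 0 x0"
proof -
  interpret markov_process_from M "{0..}" trans_prob X x0 by fact
  have S_nonneg: "0 \<le> S k" if "k \<le> n" for k
    using that
  proof (induction k)
    case (Suc k)
    then show ?case using S[of k] rate_pos[of "Suc k"] by simp
  qed (simp add: S0)
  have S_mono: "S i \<le> S k" if "i \<le> k" "k \<le> n" for i k
    using that
  proof (induction k rule: dec_induct)
    case (step k)
    then show ?case using S[of k] rate_pos[of "Suc k"] by simp
  qed simp
  \<comment> \<open>The factors of the positions before step \<open>j\<close>; together with \<open>F (n - j) j\<close> at the position of
  step \<open>j\<close> they have the same expectation for every \<open>j\<close>.\<close>
  define G where "G j \<omega> = (\<Prod>k<j. exp (- (c k * X (S k) \<omega>) / 2))" for j \<omega>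
  have G_nonneg: "0 \<le> G j \<omega>" for j \<omega> unfolding G_def by (intro prod_nonneg) auto
  have X_nonneg: "0 \<le> X (S k) \<omega>" if "k \<le> n" "\<omega> \<in> space M" for k \<omega>
    using process_state_space[OF S_nonneg] that by auto
  have G_le: "G j \<omega> \<le> 1" if "j \<le> Suc n" "\<omega> \<in> space M" for j \<omega>
    unfolding G_def using that weight_nonneg X_nonneg by (intro prod_le_1) auto
  have G_past: "G (Suc j) \<in> borel_measurable (past_sigma M X (S j))" if "j \<le> n" for j
    unfolding G_def[abs_def]
  proof (intro borel_measurable_prod)
    fix k assume "k \<in> {..<Suc j}"
    then have [measurable]: "X (S k) \<in> borel_measurable (past_sigma M X (S j))"
      using that by (intro measurable_past_sigma S_nonneg S_mono) auto
    show "(\<lambda>\<omega>. exp (- (c k * X (S k) \<omega>) / 2)) \<in> borel_measurable (past_sigma M X (S j))"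
      by measurable
  qed
  have step: "(\<integral>\<^sup>+\<omega>. ennreal (G j \<omega>) * ennreal (F (n - j) j (X (S j) \<omega>)) \<partial>M) =
      ennreal (F n 0 x0)" if "j \<le> n" for j
    using that
  proof (induction j)
    case 0
    have [measurable]: "X 0 \<in> borel_measurable M" by (rule process_measurable) simp
    have "(\<integral>\<^sup>+\<omega>. ennreal (G 0 \<omega>) * ennreal (F n 0 (X 0 \<omega>)) \<partial>M) = (\<integral>\<^sup>+\<omega>. ennreal (F n 0 x0) \<partial>M)"
      using process_start by (intro nn_integral_cong_AE) (auto simp: G_def)
    then show ?case by (simp add: S0 emeasure_space_1)
  next
    case (Suc j)
    then have j: "j < n" "j + Suc (n - Suc j) \<le> n" "n - j = Suc (n - Suc j)" by auto
    have "(\<integral>\<^sup>+\<omega>. ennreal (G (Suc j) \<omega>) * ennreal (F (n - Suc j) (Suc j) (X (S (Suc j)) \<omega>)) \<partial>M) =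
      (\<integral>\<^sup>+\<omega>. ennreal (G (Suc j) \<omega>) *
        (\<integral>\<^sup>+y. ennreal (F (n - Suc j) (Suc j) y) \<partial>trans_prob (S (Suc j) - S j) (X (S j) \<omega>)) \<partial>M)"
      using j S[OF j(1)] rate_pos[of "Suc j"] G_nonneg G_le
      by (intro markov_property_nn_integral[OF assms(1)] S_nonneg G_past) auto
    also have "\<dots> = (\<integral>\<^sup>+\<omega>. ennreal (G j \<omega>) * ennreal (F (n - j) j (X (S j) \<omega>)) \<partial>M)"
    proof (rule nn_integral_cong)
      fix \<omega> assume "\<omega> \<in> space M"
      then have "0 \<le> X (S j) \<omega>" using j by (intro X_nonneg) auto
      moreover have "G (Suc j) \<omega> = G j \<omega> * exp (- (c j * X (S j) \<omega>) / 2)" by (simp add: G_def)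
      moreover have "S (Suc j) - S j = s (Suc j)" using S[OF j(1)] by simp
      ultimately show "ennreal (G (Suc j) \<omega>) *
          (\<integral>\<^sup>+y. ennreal (F (n - Suc j) (Suc j) y) \<partial>trans_prob (S (Suc j) - S j) (X (S j) \<omega>)) =
          ennreal (G j \<omega>) * ennreal (F (n - j) j (X (S j) \<omega>))"
        unfolding j(3) by (simp only: dual_laplace_Suc_nn[OF j(2)] ennreal_mult''[OF exp_ge_zero] mult.assoc)
    qed
    finally show ?case using Suc by simp
  qed
  have meas [measurable]: "X (S k) \<in> borel_measurable M" if "k \<le> n" for k
    using that by (intro process_measurable S_nonneg)
  have "(\<integral>\<omega>. exp (- (1 / 2) * (\<Sum>k=0..n. c k * X (S k) \<omega>)) \<partial>M) =
      enn2real (\<integral>\<^sup>+\<omega>. ennreal (exp (- (1 / 2) * (\<Sum>k=0..n. c k * X (S k) \<omega>))) \<partial>M)"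
    using meas by (intro integral_eq_nn_integral) (auto intro!: borel_measurable_sum)
  also have "(\<integral>\<^sup>+\<omega>. ennreal (exp (- (1 / 2) * (\<Sum>k=0..n. c k * X (S k) \<omega>))) \<partial>M) =
      (\<integral>\<^sup>+\<omega>. ennreal (G n \<omega>) * ennreal (F (n - n) n (X (S n) \<omega>)) \<partial>M)"
  proof (rule nn_integral_cong)
    fix \<omega>
    have "exp (- (1 / 2) * (\<Sum>k=0..n. c k * X (S k) \<omega>)) = (\<Prod>k\<le>n. exp (- (c k * X (S k) \<omega>) / 2))"
      by (simp add: exp_sum[symmetric] sum_distrib_left atLeast0AtMost sum_negf sum_divide_distrib)
    also have "\<dots> = G n \<omega> * F (n - n) n (X (S n) \<omega>)"
      by (simp add: G_def lessThan_Suc_atMost[symmetric])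
    finally show "ennreal (exp (- (1 / 2) * (\<Sum>k=0..n. c k * X (S k) \<omega>))) =
        ennreal (G n \<omega>) * ennreal (F (n - n) n (X (S n) \<omega>))"
      by (simp only: ennreal_mult'[OF G_nonneg])
  qed
  also have "\<dots> = ennreal (F n 0 x0)" by (rule step) simp
  finally show ?thesis using dual_laplace_nonneg[of 0 n x0] assms(2) by simp
qed

end

section \<open>The Laplace transform of the excursion\<close>

lemma entrance_density_nonneg: "0 < b \<Longrightarrow> 0 \<le> entrance_density b y"
  by (auto simp: entrance_density_def indicator_def)

lemma killed_density_nonneg:
  assumes "0 < b"
  shows "0 \<le> killed_density b y z"
proof (cases "0 < y \<and> 0 < z")
  case True
  then have "(y - z)\<^sup>2 \<le> (y + z)\<^sup>2" by (simp add: power2_eq_square algebra_simps)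
  then show ?thesis
    using assms by (auto simp: killed_density_def divide_right_mono intro!: mult_nonneg_nonneg)
qed (auto simp: killed_density_def)

context positive_laplace_chain
begin

lemma killed_laplace_nonneg: "j + m \<le> n \<Longrightarrow> 0 \<le> A m j y"
proof (induction m arbitrary: j y)
  case 0
  then show ?case by (simp add: entrance_density_nonneg weight_pos)
next
  case (Suc m)
  then show ?case
    by (auto intro!: Bochner_Integration.integral_nonneg mult_nonneg_nonneg killed_density_nonneg weight_pos)
qed

lemma killed_laplace_Suc_nn:
  assumes "j + Suc m \<le> n"
  shows "ennreal (A (Suc m) j y) = (\<integral>\<^sup>+z. ennreal (killed_density (c j) y z) *
    ennreal (exp (- (s (Suc j) * z))) * ennreal (A m (Suc j) z) \<partial>lborel)"
proof -
  have nonneg: "0 \<le> killed_density (c j) y z * exp (- (s (Suc j) * z)) * A m (Suc j) z" for z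
    using assms by (intro mult_nonneg_nonneg killed_density_nonneg killed_laplace_nonneg weight_pos) auto
  have "ennreal (A (Suc m) j y) = (\<integral>\<^sup>+z. ennreal (killed_density (c j) y z * exp (- (s (Suc j) * z)) * A m (Suc j) z) \<partial>lborel)"
    unfolding killed_laplace.simps using integrable_killed_step[OF assms] nonneg
    by (intro nn_integral_eq_integral[symmetric]) auto
  also have "\<dots> = (\<integral>\<^sup>+z. ennreal (killed_density (c j) y z) *
    ennreal (exp (- (s (Suc j) * z))) * ennreal (A m (Suc j) z) \<partial>lborel)"
    using killed_density_nonneg[OF weight_pos] killed_laplace_nonneg assms
    by (intro nn_integral_cong) (simp add: ennreal_mult)
  finally show ?thesis .
qed

text \<open>
  The first \<open>j\<close> positions of the excursion with their Laplace factors, without the return to \<open>0\<close>.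
\<close>

definition path_weight :: "nat \<Rightarrow> (nat \<Rightarrow> real) \<Rightarrow> ennreal" where
  "path_weight j y = ennreal (entrance_density (c 0) (y 1)) *
     (\<Prod>k\<in>{1..<j}. ennreal (killed_density (c k) (y k) (y (Suc k)))) *
     (\<Prod>k\<in>{1..j}. ennreal (exp (- (s k * y k))))"

lemma measurable_path_weight [measurable]:
  assumes "1 \<le> j"
  shows "path_weight j \<in> borel_measurable (Pi\<^sub>M {1..j} (\<lambda>_. lborel))"
proof -
  have [measurable]: "(\<lambda>y. y k) \<in> borel_measurable (Pi\<^sub>M {1..j} (\<lambda>_. lborel))" if "1 \<le> k" "k \<le> j" for k
    using measurable_component_singleton[of k "{1..j}" "\<lambda>_. lborel"] that by simp
  show ?thesis
    unfolding path_weight_def[abs_def]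
    using assms by measurable
qed

text \<open>
  The joint density is integrated over its last coordinate first, each integration being one step
  of the recursion of \<open>killed_laplace\<close>. Hence the left side does not depend on \<open>j\<close>, and for \<open>j = 1\<close> it is
  the integral of \<open>entrance_killed_laplace\<close>.
\<close>

lemma path_weight_integral:
  assumes "1 \<le> j" "j \<le> n"
  shows "(\<integral>\<^sup>+y. path_weight j y * ennreal (A (n - j) j (y j)) \<partial>Pi\<^sub>M {1..j} (\<lambda>_. lborel)) =
    ennreal (1 / (4 * pi) * (LBINT x:{0..}. sqrt x * F n 0 x))"
  using assms
proof (induction j rule: dec_induct)
  case base
  then have n: "0 + Suc (n - 1) \<le> n" "Suc (n - 1) = n" by auto
  have c: "0 < c 0" by (rule weight_pos) simp
  interpret product_sigma_finite "\<lambda>_. lborel :: real measure" ..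
  have "(\<integral>\<^sup>+y. path_weight 1 y * ennreal (A (n - 1) 1 (y 1)) \<partial>Pi\<^sub>M {1..1} (\<lambda>_. lborel)) =
      (\<integral>\<^sup>+y. (\<lambda>z. ennreal (entrance_density (c 0) z) * ennreal (exp (- (s 1 * z))) *
        ennreal (A (n - 1) 1 z)) (y 1) \<partial>Pi\<^sub>M {1::nat} (\<lambda>_. lborel))"
    by (simp add: path_weight_def)
  also have "\<dots> = (\<integral>\<^sup>+z. ennreal (entrance_density (c 0) z) * ennreal (exp (- (s 1 * z))) *
      ennreal (A (n - 1) 1 z) \<partial>lborel)"
    by (rule product_nn_integral_singleton) measurable
  also have "\<dots> = (\<integral>\<^sup>+z. ennreal (entrance_density (c 0) z * exp (- (s 1 * z)) * A (n - 1) 1 z) \<partial>lborel)"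
    using entrance_density_nonneg[OF c] killed_laplace_nonneg[of 1 "n - 1"] n
    by (intro nn_integral_cong) (simp add: ennreal_mult)
  also have "\<dots> = ennreal (LBINT z. entrance_density (c 0) z * exp (- (s 1 * z)) * A (n - 1) 1 z)"
    using integrable_entrance_killed_laplace[OF n(1)] entrance_density_nonneg[OF c]
      killed_laplace_nonneg[of 1 "n - 1"] n(1)
    by (intro nn_integral_eq_integral) auto
  also have "\<dots> = ennreal (1 / (4 * pi) * (LBINT x:{0..}. sqrt x * F n 0 x))"
    using entrance_killed_laplace[OF n(1)] n(2) unfolding One_nat_def by (simp only:)
  finally show ?case .
next
  case (step j)
  interpret product_sigma_finite "\<lambda>_. lborel :: real measure" ..
  have j: "j + Suc (n - Suc j) \<le> n" "Suc (n - Suc j) = n - j" "1 \<le> j" "1 \<le> Suc j"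
    "{1..Suc j} = insert (Suc j) {1..j}"
    using step by auto
  have meas: "(\<lambda>y. path_weight (Suc j) y * ennreal (A (n - Suc j) (Suc j) (y (Suc j)))) \<in>
      borel_measurable (Pi\<^sub>M {1..Suc j} (\<lambda>_. lborel))"
  proof -
    have [measurable]: "(\<lambda>y. y (Suc j)) \<in> borel_measurable (Pi\<^sub>M {1..Suc j} (\<lambda>_. lborel))"
      using measurable_component_singleton[of "Suc j" "{1..Suc j}" "\<lambda>_. lborel"] by simp
    show ?thesis using measurable_path_weight[OF j(4)] by measurable
  qed
  \<comment> \<open>The new coordinate enters only through the last transition and the last Laplace factor.\<close>
  have split: "path_weight (Suc j) (y(Suc j := z)) =
      path_weight j y * (ennreal (killed_density (c j) (y j) z) * ennreal (exp (- (s (Suc j) * z))))" for y z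
  proof -
    have "(\<Prod>k\<in>{1..<j}. ennreal (killed_density (c k) ((y(Suc j := z)) k) ((y(Suc j := z)) (Suc k)))) =
        (\<Prod>k\<in>{1..<j}. ennreal (killed_density (c k) (y k) (y (Suc k))))"
      by (intro prod.cong) auto
    moreover have "(\<Prod>k\<in>{1..j}. ennreal (exp (- (s k * (y(Suc j := z)) k)))) =
        (\<Prod>k\<in>{1..j}. ennreal (exp (- (s k * y k))))"
      by (intro prod.cong) auto
    moreover have "{1..<Suc j} = insert j {1..<j}" "j \<notin> {1..<j}" "Suc j \<notin> {1..j}"
      using j(3) by auto
    ultimately show ?thesis
      using j(3) unfolding path_weight_def j(5) by (simp add: ac_simps)
  qed
  have "(\<integral>\<^sup>+y. path_weight (Suc j) y * ennreal (A (n - Suc j) (Suc j) (y (Suc j)))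
        \<partial>Pi\<^sub>M {1..Suc j} (\<lambda>_. lborel)) =
      (\<integral>\<^sup>+y. \<integral>\<^sup>+z. path_weight (Suc j) (y(Suc j := z)) *
        ennreal (A (n - Suc j) (Suc j) ((y(Suc j := z)) (Suc j))) \<partial>lborel \<partial>Pi\<^sub>M {1..j} (\<lambda>_. lborel))"
    using meas unfolding j(5) by (intro product_nn_integral_insert) auto
  also have "\<dots> = (\<integral>\<^sup>+y. path_weight j y * ennreal (A (n - j) j (y j)) \<partial>Pi\<^sub>M {1..j} (\<lambda>_. lborel))"
  proof (rule nn_integral_cong)
    fix y :: "nat \<Rightarrow> real"
    have "(\<integral>\<^sup>+z. path_weight (Suc j) (y(Suc j := z)) *
        ennreal (A (n - Suc j) (Suc j) ((y(Suc j := z)) (Suc j))) \<partial>lborel) =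
        (\<integral>\<^sup>+z. path_weight j y * (ennreal (killed_density (c j) (y j) z) *
          ennreal (exp (- (s (Suc j) * z))) * ennreal (A (n - Suc j) (Suc j) z)) \<partial>lborel)"
      by (simp add: split mult.assoc)
    also have "\<dots> = path_weight j y * ennreal (A (Suc (n - Suc j)) j (y j))"
      unfolding killed_laplace_Suc_nn[OF j(1)] by (rule nn_integral_cmult) measurable
    finally show "(\<integral>\<^sup>+z. path_weight (Suc j) (y(Suc j := z)) *
        ennreal (A (n - Suc j) (Suc j) ((y(Suc j := z)) (Suc j))) \<partial>lborel) =
        path_weight j y * ennreal (A (n - j) j (y j))"
      unfolding j(2) .
  qed
  also have "\<dots> = ennreal (1 / (4 * pi) * (LBINT x:{0..}. sqrt x * F n 0 x))"
    using step by simp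
  finally show ?case .
qed

lemma excursion_laplace_transform:
  assumes B: "brownian_excursion M B" and n: "1 \<le> n"
    and t: "t 0 = 0" "t (Suc n) = 1" "\<And>k. k \<le> n \<Longrightarrow> c k = t (Suc k) - t k"
  shows "(\<integral>\<omega>. exp (- (\<Sum>k=1..n. s k * B (t k) \<omega>)) \<partial>M) =
    1 / sqrt (2 * pi) * (LBINT x:{0..}. sqrt x * F n 0 x)"
proof -
  interpret brownian_excursion M B by fact
  have t_less: "t k < t (Suc k)" if "k \<le> n" for k
    using weight_pos[OF that] t(3)[OF that] by simp
  have t_mono: "t i < t k" if "i < k" "k \<le> Suc n" for i k
    using that
  proof (induction k rule: less_Suc_induct)
    case (1 i)
    then show ?case by (intro t_less) simp
  qed (auto intro: less_trans)
  let ?\<Pi> = "Pi\<^sub>M {1..n} (\<lambda>_. lborel) :: (nat \<Rightarrow> real) measure"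
  let ?e = "\<lambda>y. exp (- (\<Sum>k=1..n. s k * y k)) :: real"
  have dist: "distributed M ?\<Pi> (\<lambda>\<omega>. \<lambda>k\<in>{1..n}. B (t k) \<omega>) (\<lambda>y. ennreal (excursion_density n t y))"
    using n t(1) t(2) t_mono[of 0 1] t_mono[of n "Suc n"]
    by (intro excursion_joint_density) (auto simp: strict_mono_on_def intro!: t_mono)
  have [measurable]: "(\<lambda>y. y k) \<in> borel_measurable ?\<Pi>" if "1 \<le> k" "k \<le> n" for k
    using measurable_component_singleton[of k "{1..n}" "\<lambda>_. lborel"] that by simp
  have e: "(\<lambda>y. ennreal (?e y)) \<in> borel_measurable ?\<Pi>"
    by measurable
  have B_meas: "B (t k) \<in> borel_measurable M" if "k \<in> {1..n}" for k
    using that t_mono[of 0 k] t_mono[of k "Suc n"] t(1,2) by (intro excursion_measurable) auto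
  have "(\<integral>\<^sup>+\<omega>. ennreal (exp (- (\<Sum>k=1..n. s k * B (t k) \<omega>))) \<partial>M) =
      (\<integral>\<^sup>+\<omega>. ennreal (?e (\<lambda>k\<in>{1..n}. B (t k) \<omega>)) \<partial>M)"
    by (intro nn_integral_cong arg_cong[where f = "\<lambda>x. ennreal (exp (- x))"] sum.cong) auto
  also have "\<dots> = (\<integral>\<^sup>+y. ennreal (excursion_density n t y) * ennreal (?e y) \<partial>?\<Pi>)"
    using distributed_nn_integral[OF dist e] by simp
  also have "\<dots> = (\<integral>\<^sup>+y. ennreal (sqrt (8 * pi)) * (path_weight n y * ennreal (A (n - n) n (y n))) \<partial>?\<Pi>)"
  proof (rule nn_integral_cong)
    fix y :: "nat \<Rightarrow> real"
    have c0: "c 0 = t 1" "c n = 1 - t n" using t(1) t(2) t(3)[of 0] t(3)[of n] by auto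
    have kd: "0 \<le> killed_density (c k) a b" if "k \<le> n" for k a b
      using that by (intro killed_density_nonneg weight_pos)
    have ed: "0 \<le> entrance_density (c k) a" if "k \<le> n" for k a
      using that by (intro entrance_density_nonneg weight_pos)
    have prod: "(\<Prod>k\<in>{1..<n}. killed_density (t (k + 1) - t k) (y k) (y (k + 1))) =
        (\<Prod>k\<in>{1..<n}. killed_density (c k) (y k) (y (Suc k)))"
      using t(3) by (intro prod.cong) auto
    have "excursion_density n t y * ?e y = sqrt (8 * pi) * (entrance_density (c 0) (y 1) *
        (\<Prod>k\<in>{1..<n}. killed_density (c k) (y k) (y (Suc k))) *
        (\<Prod>k\<in>{1..n}. exp (- (s k * y k))) * entrance_density (c n) (y n))"
      unfolding excursion_density_def prod c0 by (simp add: exp_sum[symmetric] sum_negf)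
    moreover have "0 \<le> entrance_density (c n) (y n)" by (rule ed) simp
    moreover have "(\<Prod>k\<in>{1..<n}. ennreal (killed_density (c k) (y k) (y (Suc k)))) =
        ennreal (\<Prod>k\<in>{1..<n}. killed_density (c k) (y k) (y (Suc k)))"
      "0 \<le> (\<Prod>k\<in>{1..<n}. killed_density (c k) (y k) (y (Suc k)))"
      using kd by (auto intro!: prod_ennreal prod_nonneg)
    moreover have "(\<Prod>k\<in>{1..n}. ennreal (exp (- (s k * y k)))) = ennreal (\<Prod>k\<in>{1..n}. exp (- (s k * y k)))"
      "0 \<le> (\<Prod>k\<in>{1..n}. exp (- (s k * y k)))"
      by (auto intro!: prod_ennreal prod_nonneg)
    moreover have "0 \<le> sqrt (8 * pi)" by simp
    ultimately have "ennreal (excursion_density n t y * ?e y) =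
        ennreal (sqrt (8 * pi)) * (path_weight n y * ennreal (A (n - n) n (y n)))"
      unfolding path_weight_def diff_self_eq_0 killed_laplace.simps
      by (simp only: ennreal_mult' ennreal_mult'')
    then show "ennreal (excursion_density n t y) * ennreal (?e y) =
        ennreal (sqrt (8 * pi)) * (path_weight n y * ennreal (A (n - n) n (y n)))"
      by (simp add: ennreal_mult'')
  qed
  also have "\<dots> = ennreal (sqrt (8 * pi)) * (\<integral>\<^sup>+y. path_weight n y * ennreal (A (n - n) n (y n)) \<partial>?\<Pi>)"
  proof (rule nn_integral_cmult)
    have [measurable]: "(\<lambda>y. y n) \<in> borel_measurable ?\<Pi>" using n by measurable
    show "(\<lambda>y. path_weight n y * ennreal (A (n - n) n (y n))) \<in> borel_measurable ?\<Pi>"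
      using measurable_path_weight[OF n] by measurable
  qed
  also have "\<dots> = ennreal (sqrt (8 * pi)) * ennreal (1 / (4 * pi) * (LBINT x:{0..}. sqrt x * F n 0 x))"
    using n by (subst path_weight_integral) auto
  also have "\<dots> = ennreal (sqrt (8 * pi) * (1 / (4 * pi)) * (LBINT x:{0..}. sqrt x * F n 0 x))"
    unfolding mult.assoc by (rule ennreal_mult'[symmetric]) simp
  also have "sqrt (8 * pi) * (1 / (4 * pi)) = 1 / sqrt (2 * pi)"
  proof -
    have "sqrt (8 * pi) = 2 * sqrt (2 * pi)"
      using real_sqrt_mult[of 4 "2 * pi"] by simp
    moreover have "4 * pi = 2 * (sqrt (2 * pi) * sqrt (2 * pi))" by simp
    ultimately show ?thesis by (simp only:) (simp add: divide_simps)
  qed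
  finally have nn: "(\<integral>\<^sup>+\<omega>. ennreal (exp (- (\<Sum>k=1..n. s k * B (t k) \<omega>))) \<partial>M) =
      ennreal (1 / sqrt (2 * pi) * (LBINT x:{0..}. sqrt x * F n 0 x))" .
  have "0 \<le> (LBINT x:{0..}. sqrt x * F n 0 x)"
    unfolding set_lebesgue_integral_def using dual_laplace_nonneg[of 0 n]
    by (intro Bochner_Integration.integral_nonneg) (auto split: split_indicator)
  moreover have "(\<integral>\<omega>. exp (- (\<Sum>k=1..n. s k * B (t k) \<omega>)) \<partial>M) =
      enn2real (\<integral>\<^sup>+\<omega>. ennreal (exp (- (\<Sum>k=1..n. s k * B (t k) \<omega>))) \<partial>M)"
    using B_meas by (intro integral_eq_nn_integral) (auto intro!: borel_measurable_sum)
  ultimately show ?thesis unfolding nn by simp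
qed

end

section \<open>The duality\<close>

lemma dual_laplace_shift:
  "dual_laplace (\<lambda>k. c (k + a)) (\<lambda>k. s (k + a)) m j x = dual_laplace c s m (j + a) x"
  by (induction m arbitrary: j x) simp_all

text \<open>
  The duality for the empty chain; after the substitution it is the second moment of the standard
  normal distribution.
\<close>

lemma sqrt_exp_integral: "(LBINT x:{0..}. sqrt x * exp (- x / 2)) = sqrt (2 * pi)"
proof -
  have "(LBINT x:{0..}. sqrt x * exp (- x / 2)) = (LBINT u. sqrt (u\<^sup>2) * exp (- u\<^sup>2 / 2) * \<bar>u\<bar>)"
    by (rule lborel_integral_square_substitution) auto
  also have "\<dots> = (LBINT u. sqrt (2 * pi) * (std_normal_density u * u ^ (2 * 1)))"
    by (intro Bochner_Integration.integral_cong) (auto simp: std_normal_density_def power2_eq_square)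
  also have "\<dots> = sqrt (2 * pi)"
    unfolding integral_mult_right_zero integral_std_normal_moment_even by simp
  finally show ?thesis .
qed

text \<open>
  The duality for the times \<open>t k\<close> with \<open>a < k \<le> b\<close>, all of them strictly between \<open>t a = 0\<close> and
  \<open>t (b + 1) = 1\<close>; \<open>a = b\<close> is allowed. The offset \<open>a\<close> serves the case in which the first time is
  \<open>0\<close> and is removed.
\<close>

lemma excursion_laplace_transform_interior:
  fixes t s :: "nat \<Rightarrow> real"
  assumes B: "brownian_excursion M B" and "a \<le> b"
    and t: "t a = 0" "t (Suc b) = 1" "\<And>k. a \<le> k \<Longrightarrow> k \<le> b \<Longrightarrow> t k < t (Suc k)"
    and s: "\<And>k. a < k \<Longrightarrow> k \<le> b \<Longrightarrow> 0 < s k"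
  shows "(\<integral>\<omega>. exp (- (\<Sum>k\<in>{a<..b}. s k * B (t k) \<omega>)) \<partial>M) =
    1 / sqrt (2 * pi) * (LBINT x:{0..}. sqrt x * dual_laplace (\<lambda>k. t (Suc k) - t k) s (b - a) a x)"
proof (cases "a = b")
  case True
  interpret brownian_excursion M B by fact
  show ?thesis using t(1,2) sqrt_exp_integral by (simp add: True prob_space)
next
  case False
  define n where "n = b - a"
  have n: "1 \<le> n" "b = n + a" using False \<open>a \<le> b\<close> by (auto simp: n_def)
  let ?c = "\<lambda>k. t (Suc k) - t k"
  interpret positive_laplace_chain n "\<lambda>k. ?c (k + a)" "\<lambda>k. s (k + a)"
  proof
    show "0 < ?c (k + a)" if "k \<le> n" for k using that t(3)[of "k + a"] n by simp
    then show "0 \<le> ?c (k + a)" if "k \<le> n" for k using that by (simp add: less_imp_le)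
    show "0 < s (k + a)" if "1 \<le> k" "k \<le> n" for k using that s[of "k + a"] n by simp
  qed
  have "(\<Sum>k\<in>{a<..b}. s k * B (t k) \<omega>) = (\<Sum>k=1..n. s (k + a) * B (t (k + a)) \<omega>)" for \<omega>
    by (rule sum.reindex_bij_witness[of _ "\<lambda>k. k + a" "\<lambda>k. k - a"]) (auto simp: n(2))
  moreover have "F n 0 x = dual_laplace ?c s (b - a) a x" for x
    using dual_laplace_shift[of ?c a s n 0 x] n(2) by (simp del: dual_laplace.simps)
  ultimately show ?thesis
    using excursion_laplace_transform[OF B n(1), of "\<lambda>k. t (k + a)"] t(1,2) n(2)
    by (simp del: dual_laplace.simps)
qed

theorem theorem1p1:
  fixes d :: nat and s t :: "nat \<Rightarrow> real"
    and M :: "'a measure" and B :: "real \<Rightarrow> 'a \<Rightarrow> real"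
    and P :: "real \<Rightarrow> 'b measure" and X :: "real \<Rightarrow> 'b \<Rightarrow> real"
  assumes "1 \<le> d"
    and "s 0 = 0" and "\<And>k. k < d \<Longrightarrow> s k < s (k + 1)"
    and "t 0 = 0" and "0 \<le> t 1" and "\<And>k. 1 \<le> k \<Longrightarrow> k < d \<Longrightarrow> t k < t (k + 1)"
    and "t d \<le> 1" and "t (d + 1) = 1"
    and "brownian_excursion M B"
    and "\<And>x. 0 < x \<Longrightarrow> markov_process_from (P x) {0..} trans_prob X x"
  shows "(\<integral>\<omega>. exp (- (\<Sum>k=1..d. (s k - s (k - 1)) * B (t k) \<omega>)) \<partial>M) =
    1 / sqrt (2 * pi) *
      (LBINT x:{0<..}. (\<integral>\<omega>. exp (- (1 / 2) * (\<Sum>k=0..d. (t (k + 1) - t k) * X (s k) \<omega>)) \<partial>(P x)) * sqrt x)"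
proof -
  define c r where "c k = t (Suc k) - t k" and "r k = s k - s (k - 1)" for k
  interpret brownian_excursion M B by fact
  interpret laplace_chain d c r
  proof
    show "0 < r k" if "1 \<le> k" "k \<le> d" for k
      using that assms(3)[of "k - 1"] by (simp add: r_def)
    show "0 \<le> c k" if "k \<le> d" for k
    proof -
      consider "k = 0" | "1 \<le> k" "k < d" | "k = d" using \<open>k \<le> d\<close> by linarith
      then show ?thesis using assms(4-8) by cases (auto simp: c_def less_imp_le)
    qed
  qed
  \<comment> \<open>A first time \<open>0\<close> and a last time \<open>1\<close> are removed; the indices in \<open>{a<..b}\<close> are those of
  the times in \<open>(0, 1)\<close>.\<close>
  define a b where "a = (if t 1 = 0 then 1 else 0 :: nat)" and "b = (if t d = 1 then d - 1 else d)"
  have b: "b \<le> d" "Suc b = d \<and> t d = 1 \<or> b = d \<and> t d \<noteq> 1"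
    using assms(1) by (auto simp: b_def)
  have a: "a = 1 \<and> t 1 = 0 \<and> 1 \<le> b \<or> a = 0 \<and> t 1 \<noteq> 0"
    using assms(1) b by (cases "d = 1") (auto simp: a_def)
  have last: "F d 0 x = F b 0 x" if "0 \<le> x" for x
    using b(2) that dual_laplace_drop_last[of 0 b x] assms(8)
    by (auto simp: c_def simp del: dual_laplace.simps)
  have first: "(LBINT x:{0..}. sqrt x * F b 0 x) = (LBINT x:{0..}. sqrt x * F (b - a) a x)"
  proof (cases "a = 1")
    case True
    with a b(1) have "0 + Suc (b - 1) \<le> d" "Suc (b - 1) = b" "t 1 = 0" by auto
    then show ?thesis
      using dual_laplace_drop_first[of 0 "b - 1"] True assms(4)
      by (simp add: c_def del: dual_laplace.simps)
  qed (use a in simp)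
  have X: "(\<integral>\<omega>. exp (- (1 / 2) * (\<Sum>k=0..d. (t (k + 1) - t k) * X (s k) \<omega>)) \<partial>(P x)) = F d 0 x"
    if "0 < x" for x
    using markov_laplace_functional[OF assms(10)[OF that], of s] that assms(2)
    by (simp add: c_def r_def)
  have "(LBINT x:{0<..}. (\<integral>\<omega>. exp (- (1 / 2) * (\<Sum>k=0..d. (t (k + 1) - t k) * X (s k) \<omega>)) \<partial>(P x)) * sqrt x) =
      (LBINT x:{0..}. sqrt x * F b 0 x)"
    unfolding set_lebesgue_integral_def
  proof (intro Bochner_Integration.integral_cong refl)
    fix x :: real
    show "indicator {0<..} x *\<^sub>R
        ((\<integral>\<omega>. exp (- (1 / 2) * (\<Sum>k=0..d. (t (k + 1) - t k) * X (s k) \<omega>)) \<partial>(P x)) * sqrt x) =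
        indicator {0..} x *\<^sub>R (sqrt x * F b 0 x)"
      \<comment> \<open>The point \<open>0\<close> may be added to the domain, since the factor \<open>sqrt x\<close> vanishes there.\<close>
      using X[of x] last[of x] by (cases x "0::real" rule: linorder_cases) auto
  qed
  also have "1 / sqrt (2 * pi) * \<dots> = (\<integral>\<omega>. exp (- (\<Sum>k\<in>{a<..b}. r k * B (t k) \<omega>)) \<partial>M)"
    unfolding first unfolding c_def[abs_def]
  proof (rule excursion_laplace_transform_interior[symmetric])
    show "a \<le> b" "t a = 0" "t (Suc b) = 1" using a b assms(4,8) by auto
    show "t k < t (Suc k)" if "a \<le> k" "k \<le> b" for k
    proof -
      have "k = 0 \<and> a = 0 \<or> 1 \<le> k \<and> k < d \<or> k = d \<and> b = d" using that a b by auto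
      then show ?thesis
        using a b assms(4,5,7,8) assms(6)[of k] by auto
    qed
    show "0 < r k" if "a < k" "k \<le> b" for k using that b(1) by (intro rate_pos) auto
  qed fact
  also have "\<dots> = (\<integral>\<omega>. exp (- (\<Sum>k=1..d. (s k - s (k - 1)) * B (t k) \<omega>)) \<partial>M)"
  proof (rule integral_cong_AE)
    have t_mono: "t i \<le> t k" if "i \<le> k" "1 \<le> i" "k \<le> d" for i k
      using that(1,3)
    proof (induction k rule: dec_induct)
      case (step k)
      then show ?case using assms(6)[of k] that(2) by auto
    qed simp
    have B_meas [measurable]: "B (t k) \<in> borel_measurable M" if "1 \<le> k" "k \<le> d" for k
      using t_mono[of 1 k] t_mono[of k d] that assms(5,7) by (intro excursion_measurable) auto
    have "B (t k) \<in> borel_measurable M" if "a < k" "k \<le> b" for k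
      using that b(1) by (intro B_meas) auto
    then show "(\<lambda>\<omega>. exp (- (\<Sum>k\<in>{a<..b}. r k * B (t k) \<omega>))) \<in> borel_measurable M"
      by (auto intro!: borel_measurable_sum)
    show "(\<lambda>\<omega>. exp (- (\<Sum>k=1..d. (s k - s (k - 1)) * B (t k) \<omega>))) \<in> borel_measurable M"
      by measurable
    show "AE \<omega> in M. exp (- (\<Sum>k\<in>{a<..b}. r k * B (t k) \<omega>)) =
        exp (- (\<Sum>k=1..d. (s k - s (k - 1)) * B (t k) \<omega>))"
      using excursion_start excursion_end
    proof eventually_elim
      case (elim \<omega>)
      have "r k * B (t k) \<omega> = 0" if "k \<in> {1..d} - {a<..b}" for k
      proof -
        have "k = 1 \<and> t 1 = 0 \<or> k = d \<and> t d = 1" using that a b by auto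
        then show ?thesis using elim by auto
      qed
      then have "(\<Sum>k\<in>{a<..b}. r k * B (t k) \<omega>) = (\<Sum>k=1..d. r k * B (t k) \<omega>)"
        using b(1) by (intro sum.mono_neutral_left) auto
      then show ?case by (simp add: r_def)
    qed
  qed
  finally show ?thesis ..
qed

end
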